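(* Let $\mathcal K$ be one of the categories $\mathcal P$, $\mathcal{PB}$ or $\mathcal B$, let $m,n\in\mathbb N$ with $m\geq n$, and let $\sigma\in\mathcal K_{nm}$ with $r=\operatorname{rank}(\sigma)$. (i) If $r<n$, then the maximal $\mathscr J^\sigma$-classes of $\mathcal K_{mn}^\sigma$ are the singleton sets $\{\alpha\}$ for $\alpha\in\mathcal K_{mn}$ with $\operatorname{rank}(\alpha)>r$. (ii) If $r=n$, then the set $D_r^\sigma=\{\alpha\in P^\sigma:\operatorname{rank}(\alpha)=r\}$ is the maximum $\mathscr J^\sigma$-class of $\mathcal K_{mn}^\sigma$; it is a left-group over the symmetric group $\mathcal S_r$.
   Context: $\mathbb N=\{0,1,2,\ldots\}$, $[n]=\{1,\ldots,n\}$ (with $[0]=\emptyset$), and $A'=\{a':a\in A\}$, $A''=\{a'':a\in A\}$ for $A\subseteq\mathbb N$. $\mathcal P_{mn}$ is the set of all set partitions of $[m]\cup[n]'$, and $\mathcal P=\bigcup_{m,n\in\mathbb N}\mathcal P_{mn}$. For $\alpha\in\mathcal P_{mn}$ and $\beta\in\mathcal P_{nk}$, the product $\alpha\beta\in\mathcal P_{mk}$ is formed as follows: identify partitions with graphs whose connected components are the blocks; let $\alpha_\downarrow$ be the graph on $[m]\cup[n]''$ obtained from $\alpha$ by renaming each $x'$ to $x''$, let $\beta^\uparrow$ be the graph on $[n]''\cup[k]'$ obtained from $\beta$ by renaming each $x\in[n]$ to $x''$, and let $\Pi(\alpha,\beta)$ be their union on $[m]\cup[n]''\cup[k]'$; two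 elements of $[m]\cup[k]'$ are in the same block of $\alpha\beta$ iff they are in the same component of $\Pi(\alpha,\beta)$. The rank of $\alpha\in\mathcal P_{mn}$ is the number of blocks meeting both $[m]$ and $[n]'$. $\mathcal B$ (Brauer category) consists of the partitions all of whose blocks have size $2$; $\mathcal{PB}$ (partial Brauer category) of those all of whose blocks have size $1$ or $2$. $\mathcal K_{mn}=\mathcal K\cap\mathcal P_{mn}$. For $\sigma\in\mathcal K_{nm}$, $\mathcal K_{mn}^\sigma$ is the set $\mathcal K_{mn}$ with operation $\alpha\star_\sigma\beta=\alpha\sigma\beta$. $P^\sigma=\operatorname{Reg}(\mathcal K_{mn}^\sigma)$ is the subsemigroup of (von Neumann) regular elements of $\mathcal K_{mn}^\sigma$. $\mathscr J^\sigma$ is Green's $\mathscr J$ relation of the semigroup $\mathcal K_{mn}^\sigma$; $\mathscr J^\sigma$-classes are ordered by the usual order $J_\alpha\le J_\beta$ iff $\alpha$ belongs to the principal two-sided ideal of $\mathcal K_{mn}^\sigma$ generated by $\beta$, and "maximal" and "maximum" refer to this order. A left-group over a group $G$ is a semigroup isomorphic to a direct product of a left-zero semigroup (multiplication $uv=u$) with $G$. *)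

theory Defs
  imports "HOL-Algebra.Sym_Groups" "HOL-Library.Disjoint_Sets"
begin

text \<open>
  The points \<open>x\<close>, \<open>x'\<close> and \<open>x''\<close> are \<open>Plain x\<close>, \<open>Prime x\<close> and \<open>DPrime x\<close>.  Indices start at 1.
\<close>

datatype point = Plain nat | Prime nat | DPrime nat

type_synonym diagram = "point set set"

definition points :: "nat \<Rightarrow> nat \<Rightarrow> point set" where
  "points m n = Plain ` {1..m} \<union> Prime ` {1..n}"

definition partition_cat :: "nat \<Rightarrow> nat \<Rightarrow> diagram set" where
  "partition_cat m n = {\<alpha>. partition_on (points m n) \<alpha>}"

definition partial_brauer_cat :: "nat \<Rightarrow> nat \<Rightarrow> diagram set" where
  "partial_brauer_cat m n = {\<alpha> \<in> partition_cat m n. \<forall>A\<in>\<alpha>. card A = 1 \<or> card A = 2}"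

definition brauer_cat :: "nat \<Rightarrow> nat \<Rightarrow> diagram set" where
  "brauer_cat m n = {\<alpha> \<in> partition_cat m n. \<forall>A\<in>\<alpha>. card A = 2}"

definition rank :: "diagram \<Rightarrow> nat" where
  "rank \<alpha> = card {A \<in> \<alpha>. A \<inter> range Plain \<noteq> {} \<and> A \<inter> range Prime \<noteq> {}}"

text \<open>
  A partition is identified with the graph in which each block is a complete graph (with loops).
\<close>

definition edges :: "diagram \<Rightarrow> (point \<times> point) set" where
  "edges \<alpha> = (\<Union>A\<in>\<alpha>. A \<times> A)"

fun lower_to_middle :: "point \<Rightarrow> point" where
  "lower_to_middle (Plain x) = Plain x"
| "lower_to_middle (Prime x) = DPrime x"
| "lower_to_middle (DPrime x) = DPrime x"

fun upper_to_middle :: "point \<Rightarrow> point" where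
  "upper_to_middle (Plain x) = DPrime x"
| "upper_to_middle (Prime x) = Prime x"
| "upper_to_middle (DPrime x) = DPrime x"

definition product_graph :: "diagram \<Rightarrow> diagram \<Rightarrow> (point \<times> point) set" where
  "product_graph \<alpha> \<beta> =
     edges ((`) lower_to_middle ` \<alpha>) \<union> edges ((`) upper_to_middle ` \<beta>)"

text \<open>
  The product of \<open>\<alpha> \<in> partition_cat m n\<close> and \<open>\<beta> \<in> partition_cat n k\<close>.  The edge relation is
  symmetric, so two points lie in the same component iff they are related by its
  reflexive transitive closure.
\<close>

definition diagram_prod :: "nat \<Rightarrow> nat \<Rightarrow> diagram \<Rightarrow> diagram \<Rightarrow> diagram" where
  "diagram_prod m k \<alpha> \<beta> =
     points m k // {(x, y) \<in> points m k \<times> points m k. (x, y) \<in> (product_graph \<alpha> \<beta>)\<^sup>*}"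

text \<open>
  A semigroup is represented by a monoid record whose field \<open>one\<close> is ignored; neither the notions
  below nor \<open>iso\<close> refer to it (only \<open>G\<close> in \<open>left_group_over\<close> is a genuine group).
\<close>

definition is_semigroup :: "('a, 'b) monoid_scheme \<Rightarrow> bool" where
  "is_semigroup S \<longleftrightarrow>
     (\<forall>x\<in>carrier S. \<forall>y\<in>carrier S. x \<otimes>\<^bsub>S\<^esub> y \<in> carrier S) \<and>
     (\<forall>x\<in>carrier S. \<forall>y\<in>carrier S. \<forall>z\<in>carrier S.
        (x \<otimes>\<^bsub>S\<^esub> y) \<otimes>\<^bsub>S\<^esub> z = x \<otimes>\<^bsub>S\<^esub> (y \<otimes>\<^bsub>S\<^esub> z))"

definition regular_elements :: "('a, 'b) monoid_scheme \<Rightarrow> 'a set" where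
  "regular_elements S = {a \<in> carrier S. \<exists>x\<in>carrier S. a = a \<otimes>\<^bsub>S\<^esub> x \<otimes>\<^bsub>S\<^esub> a}"

definition two_sided_ideal :: "('a, 'b) monoid_scheme \<Rightarrow> 'a \<Rightarrow> 'a set" where
  "two_sided_ideal S a =
     {a} \<union> {x \<otimes>\<^bsub>S\<^esub> a | x. x \<in> carrier S} \<union> {a \<otimes>\<^bsub>S\<^esub> y | y. y \<in> carrier S} \<union>
     {x \<otimes>\<^bsub>S\<^esub> a \<otimes>\<^bsub>S\<^esub> y | x y. x \<in> carrier S \<and> y \<in> carrier S}"

definition J_rel :: "('a, 'b) monoid_scheme \<Rightarrow> ('a \<times> 'a) set" where
  "J_rel S = {(a, b) \<in> carrier S \<times> carrier S. two_sided_ideal S a = two_sided_ideal S b}"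

definition J_classes :: "('a, 'b) monoid_scheme \<Rightarrow> 'a set set" where
  "J_classes S = carrier S // J_rel S"

text \<open>On \<open>\<J>\<close>-classes this does not depend on the choice of the representatives.\<close>

definition J_le :: "('a, 'b) monoid_scheme \<Rightarrow> 'a set \<Rightarrow> 'a set \<Rightarrow> bool" where
  "J_le S C D \<longleftrightarrow> (\<exists>a\<in>C. \<exists>b\<in>D. a \<in> two_sided_ideal S b)"

definition maximal_J_class :: "('a, 'b) monoid_scheme \<Rightarrow> 'a set \<Rightarrow> bool" where
  "maximal_J_class S C \<longleftrightarrow>
     C \<in> J_classes S \<and> (\<forall>D\<in>J_classes S. J_le S C D \<longrightarrow> D = C)"

definition maximum_J_class :: "('a, 'b) monoid_scheme \<Rightarrow> 'a set \<Rightarrow> bool" where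
  "maximum_J_class S C \<longleftrightarrow> C \<in> J_classes S \<and> (\<forall>D\<in>J_classes S. J_le S D C)"

definition left_zero :: "'a set \<Rightarrow> 'a monoid" where
  "left_zero U = \<lparr>carrier = U, mult = (\<lambda>u v. u), one = undefined\<rparr>"

text \<open>
  Taking \<open>U\<close> in the element type of \<open>S\<close> is no restriction: if \<open>S\<close> is isomorphic to the product of a
  left-zero semigroup with \<open>G\<close>, then that left-zero semigroup embeds in \<open>S\<close>.
\<close>

definition left_group_over :: "('a, 'b) monoid_scheme \<Rightarrow> ('c, 'd) monoid_scheme \<Rightarrow> bool" where
  "left_group_over S G \<longleftrightarrow>
     is_semigroup S \<and> group G \<and> (\<exists>U :: 'a set. U \<noteq> {} \<and> S \<cong> left_zero U \<times>\<times> G)"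

definition sandwich ::
    "(nat \<Rightarrow> nat \<Rightarrow> diagram set) \<Rightarrow> nat \<Rightarrow> nat \<Rightarrow> diagram \<Rightarrow> diagram monoid" where
  "sandwich K m n \<sigma> =
     \<lparr>carrier = K m n,
      mult = (\<lambda>\<alpha> \<beta>. diagram_prod m n (diagram_prod m m \<alpha> \<sigma>) \<beta>),
      one = undefined\<rparr>"

definition D_class ::
    "(nat \<Rightarrow> nat \<Rightarrow> diagram set) \<Rightarrow> nat \<Rightarrow> nat \<Rightarrow> diagram \<Rightarrow> nat \<Rightarrow> diagram set" where
  "D_class K m n \<sigma> r = {\<alpha> \<in> regular_elements (sandwich K m n \<sigma>). rank \<alpha> = r}"

end

theory Submission imports Defs begin

text \<open>
  Write \<open>K\<close> for the hom-set in question, \<open>\<star>\<close> for the sandwich product and \<open>r\<close> for the rank of \<open>\<sigma>\<close>.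

  Suppose \<open>r < n\<close>.  Every proper product \<open>\<gamma> \<star> \<delta> = \<gamma>\<sigma>\<delta>\<close> has rank at most \<open>r\<close>, so an element of rank
  greater than \<open>r\<close> lies in no principal ideal but its own: it is a \<open>\<J>\<close>-class by itself, and a
  maximal one.  Conversely, an element \<open>\<alpha>\<close> of rank at most \<open>r\<close> lies strictly below some \<open>\<beta>\<close> of
  rank greater than \<open>r\<close>.  Two facts give this.  First (\<open>factor_through_diagram\<close>), if
  \<open>rank \<alpha> \<le> rank \<tau>\<close> then \<open>\<alpha> = \<gamma>\<tau>\<delta>\<close> for suitable \<open>\<gamma>\<close> and \<open>\<delta>\<close>; in the Brauer category this needs a
  parity condition.  Second (\<open>higher_rank_preserving\<close>), there is \<open>\<beta> \<in> K\<close> of rank greater than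
  \<open>r\<close> for which \<open>\<sigma>\<beta>\<sigma>\<close> still has rank at least \<open>r\<close>.  Then \<open>\<alpha> = \<gamma>\<sigma>\<beta>\<sigma>\<delta> = \<gamma> \<star> \<beta> \<star> \<delta>\<close>.

  Such a \<open>\<beta>\<close> joins a chosen lower point of each transversal of \<open>\<sigma>\<close> to a chosen upper point of a
  transversal, and one unused lower point \<open>b\<close> of \<open>\<sigma>\<close> to one unused upper point \<open>a\<close>.  If \<open>a\<close> or \<open>b\<close>
  can be chosen outside the transversals, then joining each transversal to itself gives
  \<open>\<sigma>\<beta>\<sigma> = \<sigma>\<close>.  Otherwise all blocks of \<open>\<sigma>\<close> are transversals, which can happen
  only in the partition category; the block of \<open>a\<close> may then differ from the block of \<open>b\<close>, and
  matching each transversal to itself would let the edge from \<open>b\<close> to \<open>a\<close> merge the two.  Matching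
  along the transposition of these two blocks avoids this.

  Suppose \<open>r = n\<close>.  Factoring the identity through \<open>\<sigma>\<close> yields \<open>\<rho> \<in> K\<close> with \<open>\<sigma>\<rho>\<close> the identity, so
  \<open>\<rho>\<close> is a right identity for \<open>\<star>\<close>.  Diagrams of rank \<open>n\<close> on \<open>n + n\<close> points are permutations, and
  the regular elements of rank \<open>n\<close> turn out to be exactly the \<open>\<alpha>\<close> for which \<open>\<sigma>\<alpha>\<close> is a permutation.
  These are also exactly the \<open>\<alpha>\<close> generating the same ideal as \<open>\<rho>\<close>, an ideal that contains \<open>K\<close>.  The
  map \<open>\<alpha> \<mapsto> (\<alpha>(\<sigma>\<alpha>)\<^sup>-\<^sup>1, \<sigma>\<alpha>)\<close> is the isomorphism onto the product of a left-zero semigroup and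
  the symmetric group.

  Closure of the Brauer and partial Brauer categories under composition is never used, only closure
  under multiplication by a permutation.  Composites are compared by drawing the factors between
  consecutive layers of points.  Connections are shown by paths, and the absence of connections by
  colourings of the layers that are constant along edges.
\<close>

section \<open>Diagrams as equivalence relations\<close>

lemma points_simps [simp]:
  "Plain x \<in> points m n \<longleftrightarrow> x \<in> {1..m}"
  "Prime x \<in> points m n \<longleftrightarrow> x \<in> {1..n}"
  "DPrime x \<notin> points m n"
  by (auto simp: points_def)

lemma points_cases:
  assumes "z \<in> points m n"
  obtains x where "z = Plain x" "x \<in> {1..m}" | x where "z = Prime x" "x \<in> {1..n}"
  using assms by (cases z) auto

lemma finite_points [simp]: "finite (points m n)"
  by (simp add: points_def)

lemma card_points: "card (points m n) = m + n"
proof -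
  have "card (points m n) = card (Plain ` {1..m}) + card (Prime ` {1..n})"
    unfolding points_def by (rule card_Un_disjoint) auto
  then show ?thesis by (simp add: card_image inj_on_def)
qed

lemma edges_iff: "(x, y) \<in> edges \<alpha> \<longleftrightarrow> (\<exists>A\<in>\<alpha>. x \<in> A \<and> y \<in> A)"
  by (auto simp: edges_def)

lemma edges_sym: "(x, y) \<in> edges \<alpha> \<Longrightarrow> (y, x) \<in> edges \<alpha>"
  by (auto simp: edges_iff)

lemma edges_trans:
  assumes "\<alpha> \<in> partition_cat m n" "(x, y) \<in> edges \<alpha>" "(y, z) \<in> edges \<alpha>"
  shows "(x, z) \<in> edges \<alpha>"
proof -
  obtain A B where "A \<in> \<alpha>" "x \<in> A" "y \<in> A" "B \<in> \<alpha>" "y \<in> B" "z \<in> B"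
    using assms(2,3) by (auto simp: edges_iff)
  moreover have "disjoint \<alpha>"
    using assms(1) by (auto simp: partition_cat_def partition_on_def)
  ultimately have "A = B" by (auto simp: disjoint_def)
  with \<open>A \<in> \<alpha>\<close> \<open>x \<in> A\<close> \<open>z \<in> B\<close> show ?thesis by (auto simp: edges_iff)
qed

lemma edges_points:
  assumes "\<alpha> \<in> partition_cat m n" "(x, y) \<in> edges \<alpha>"
  shows "x \<in> points m n" "y \<in> points m n"
  using assms by (auto simp: partition_cat_def partition_on_def edges_iff)

lemma edges_refl:
  assumes "\<alpha> \<in> partition_cat m n" "x \<in> points m n"
  shows "(x, x) \<in> edges \<alpha>"
  using assms by (auto simp: partition_cat_def partition_on_def edges_iff)

lemma block_eq:
  assumes "\<alpha> \<in> partition_cat m n" "A \<in> \<alpha>" "B \<in> \<alpha>" "x \<in> A" "x \<in> B"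
  shows "A = B"
  using assms by (auto simp: partition_cat_def partition_on_def disjoint_def)

lemma block_of_edge:
  assumes "\<alpha> \<in> partition_cat m n" "A \<in> \<alpha>" "x \<in> A"
  shows "(x, y) \<in> edges \<alpha> \<longleftrightarrow> y \<in> A"
  using block_eq[OF assms(1)] assms by (auto simp: edges_iff)

lemma block_subset:
  assumes "\<alpha> \<in> partition_cat m n" "A \<in> \<alpha>" shows "A \<subseteq> points m n"
  using assms by (auto simp: partition_cat_def partition_on_def)

lemma finite_diagram:
  assumes "\<alpha> \<in> partition_cat m n" shows "finite \<alpha>"
proof -
  have "\<alpha> \<subseteq> Pow (points m n)" using block_subset[OF assms] by blast
  then show ?thesis by (rule finite_subset) simp
qed

lemma diagram_eqI:
  assumes "\<alpha> \<in> partition_cat m n" "\<beta> \<in> partition_cat m n" "edges \<alpha> = edges \<beta>"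
  shows "\<alpha> = \<beta>"
proof -
  have e: "edges \<gamma> = {(x, y). \<exists>p\<in>\<gamma>. x \<in> p \<and> y \<in> p}" for \<gamma>
    unfolding edges_def by blast
  have "\<gamma> = points m n // edges \<gamma>" if "\<gamma> \<in> partition_cat m n" for \<gamma>
    using that partition_on_eq_quotient[of "points m n" \<gamma>] by (simp add: e partition_cat_def)
  then show ?thesis using assms by metis
qed

lemma edges_quotient:
  assumes "equiv A r" shows "edges (A // r) = r"
proof (intro equalityI subrelI)
  fix x y assume "(x, y) \<in> edges (A // r)"
  then show "(x, y) \<in> r"
    using assms by (metis edges_iff quotient_eq_iff)
next
  fix x y assume "(x, y) \<in> r"
  then have "x \<in> A" "(x, x) \<in> r"
    using assms by (auto simp: equiv_def refl_on_def)
  then have "r `` {x} \<in> A // r" "x \<in> r `` {x}" "y \<in> r `` {x}"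
    using \<open>(x, y) \<in> r\<close> by (auto intro: quotientI)
  then show "(x, y) \<in> edges (A // r)" unfolding edges_iff by blast
qed

lemma sym_product_graph: "sym (product_graph \<alpha> \<beta>)"
  unfolding product_graph_def by (intro symI) (auto dest: edges_sym)

lemma equiv_prod:
  "equiv (points m k) {(x, y) \<in> points m k \<times> points m k. (x, y) \<in> (product_graph \<alpha> \<beta>)\<^sup>*}"
proof (rule equivI)
  show "sym {(x, y) \<in> points m k \<times> points m k. (x, y) \<in> (product_graph \<alpha> \<beta>)\<^sup>*}"
    using symD[OF sym_rtrancl[OF sym_product_graph]] by (auto intro: symI)
  show "trans {(x, y) \<in> points m k \<times> points m k. (x, y) \<in> (product_graph \<alpha> \<beta>)\<^sup>*}"
    by (rule transI) auto
qed (auto simp: refl_on_def)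

lemma edges_prod:
  "(x, y) \<in> edges (diagram_prod m k \<alpha> \<beta>) \<longleftrightarrow>
     x \<in> points m k \<and> y \<in> points m k \<and> (x, y) \<in> (product_graph \<alpha> \<beta>)\<^sup>*"
  unfolding diagram_prod_def edges_quotient[OF equiv_prod] by auto

lemma prod_in_cat [simp]: "diagram_prod m k \<alpha> \<beta> \<in> partition_cat m k"
  unfolding partition_cat_def diagram_prod_def
  using equiv_prod partition_on_quotient by blast

section \<open>Composition and associativity through layers\<close>

text \<open>
  \<open>lab i j\<close> places the upper points of a diagram on layer \<open>i\<close> and the lower points on layer \<open>j\<close>;
  the layer of a point is its first component.  Doubly primed points do not occur in the diagrams
  concerned, and their image is immaterial.
\<close>

fun lab :: "nat \<Rightarrow> nat \<Rightarrow> point \<Rightarrow> nat \<times> nat" where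
  "lab i j (Plain x) = (i, x)"
| "lab i j (Prime x) = (j, x)"
| "lab i j (DPrime x) = (j, x)"

text \<open>
  The edges of a diagram drawn between the layers \<open>i\<close> and \<open>j\<close>.
\<close>

definition layer :: "nat \<Rightarrow> nat \<Rightarrow> diagram \<Rightarrow> ((nat \<times> nat) \<times> (nat \<times> nat)) set" where
  "layer i j \<alpha> = map_prod (lab i j) (lab i j) ` edges \<alpha>"

lemma rtrancl_map_prod:
  assumes "inj f"
  shows "(f x, f y) \<in> (map_prod f f ` R)\<^sup>* \<longleftrightarrow> (x, y) \<in> R\<^sup>*"
proof
  have "\<exists>z. w = f z \<and> (x, z) \<in> R\<^sup>*" if "(f x, w) \<in> (map_prod f f ` R)\<^sup>*" for w
    using that
  proof (induction rule: rtrancl_induct)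
    case base
    then show ?case by blast
  next
    case (step u v)
    then obtain z a b where "u = f z" "(x, z) \<in> R\<^sup>*" "(a, b) \<in> R" "u = f a" "v = f b" by auto
    with assms have "(z, b) \<in> R" by (auto dest: injD)
    with \<open>(x, z) \<in> R\<^sup>*\<close> have "(x, b) \<in> R\<^sup>*" by (rule rtrancl_into_rtrancl)
    with \<open>v = f b\<close> show ?case by blast
  qed
  moreover assume "(f x, f y) \<in> (map_prod f f ` R)\<^sup>*"
  ultimately obtain z where "f y = f z" "(x, z) \<in> R\<^sup>*" by blast
  then show "(x, y) \<in> R\<^sup>*" using assms by (auto dest: injD)
next
  assume "(x, y) \<in> R\<^sup>*"
  then show "(f x, f y) \<in> (map_prod f f ` R)\<^sup>*"
  proof (induction rule: rtrancl_induct)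
    case (step y z)
    then have "(f y, f z) \<in> map_prod f f ` R" by auto
    with step.IH show ?case by (rule rtrancl_into_rtrancl)
  qed simp
qed

lemma layer_image:
  assumes "\<And>A z. A \<in> \<alpha> \<Longrightarrow> z \<in> A \<Longrightarrow> f (g z) = lab i j z"
  shows "map_prod f f ` edges ((`) g ` \<alpha>) = layer i j \<alpha>"
proof -
  have "map_prod f f ` edges ((`) g ` \<alpha>) = (\<Union>A\<in>\<alpha>. (f ` g ` A) \<times> (f ` g ` A))"
    by (auto simp: edges_def map_prod_def image_iff) blast+
  also have "\<dots> = (\<Union>A\<in>\<alpha>. (lab i j ` A) \<times> (lab i j ` A))"
    using assms by (intro SUP_cong refl) (simp add: image_image)
  also have "\<dots> = layer i j \<alpha>"
    by (auto simp: layer_def edges_def map_prod_def image_iff) blast+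
  finally show ?thesis .
qed

text \<open>
  The composite is computed by drawing the two factors between any three distinct layers.
\<close>

lemma prod_layer:
  assumes "\<alpha> \<in> partition_cat a b" "\<beta> \<in> partition_cat b c" "i \<noteq> j" "j \<noteq> k" "i \<noteq> k"
  shows "(x, y) \<in> edges (diagram_prod a c \<alpha> \<beta>) \<longleftrightarrow>
     x \<in> points a c \<and> y \<in> points a c \<and>
     (lab i k x, lab i k y) \<in> (layer i j \<alpha> \<union> layer j k \<beta>)\<^sup>*"
proof -
  define f where "f = (\<lambda>z. case z of Plain x \<Rightarrow> (i, x) | Prime x \<Rightarrow> (k, x) | DPrime x \<Rightarrow> (j, x))"
  have f: "inj f" using assms(3-5) by (auto simp: inj_def f_def split: point.splits)
  have "map_prod f f ` edges ((`) lower_to_middle ` \<alpha>) = layer i j \<alpha>"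
  proof (rule layer_image)
    fix A z assume "A \<in> \<alpha>" "z \<in> A"
    show "f (lower_to_middle z) = lab i j z" by (cases z) (auto simp: f_def)
  qed
  moreover have "map_prod f f ` edges ((`) upper_to_middle ` \<beta>) = layer j k \<beta>"
  proof (rule layer_image)
    fix A z assume "A \<in> \<beta>" "z \<in> A"
    then have "z \<in> points b c" using block_subset[OF assms(2)] by blast
    then show "f (upper_to_middle z) = lab j k z" by (cases z) (auto simp: f_def)
  qed
  ultimately have g: "map_prod f f ` product_graph \<alpha> \<beta> = layer i j \<alpha> \<union> layer j k \<beta>"
    by (simp add: product_graph_def image_Un)
  have "(lab i k x, lab i k y) \<in> (layer i j \<alpha> \<union> layer j k \<beta>)\<^sup>* \<longleftrightarrow> (x, y) \<in> (product_graph \<alpha> \<beta>)\<^sup>*"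
    if "x \<in> points a c" "y \<in> points a c"
  proof -
    have "lab i k z = f z" if "z \<in> points a c" for z using that by (cases z) (auto simp: f_def)
    then show ?thesis using rtrancl_map_prod[OF f, of x y "product_graph \<alpha> \<beta>"] that g by simp
  qed
  then show ?thesis by (auto simp: edges_prod)
qed

text \<open>
  The interior vertices \<open>M\<close> of a graph \<open>G\<close>, which the graph \<open>H\<close> does not touch, can be eliminated:
  \<open>G\<close> may be replaced by its connectivity relation on the remaining vertices.
\<close>

lemma rtrancl_eliminate:
  assumes H: "\<And>p q. (p, q) \<in> H \<Longrightarrow> p \<notin> M \<and> q \<notin> M" and x: "x \<notin> M" and y: "y \<notin> M"
  shows "(x, y) \<in> (G \<union> H)\<^sup>* \<longleftrightarrow> (x, y) \<in> ((G\<^sup>* \<inter> (-M) \<times> (-M)) \<union> H)\<^sup>*"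
    (is "_ \<longleftrightarrow> _ \<in> (?G' \<union> H)\<^sup>*")
proof
  assume "(x, y) \<in> (G \<union> H)\<^sup>*"
  then have "\<exists>z. z \<notin> M \<and> (x, z) \<in> (?G' \<union> H)\<^sup>* \<and> (z, y) \<in> G\<^sup>*"
  proof (induction rule: rtrancl_induct)
    case base
    then show ?case using x by blast
  next
    case (step u v)
    then obtain z where z: "z \<notin> M" "(x, z) \<in> (?G' \<union> H)\<^sup>*" "(z, u) \<in> G\<^sup>*" by blast
    show ?case
    proof (cases "(u, v) \<in> G")
      case True
      then show ?thesis using z by (meson rtrancl.rtrancl_into_rtrancl)
    next
      case False
      with step.hyps(2) have uv: "(u, v) \<in> H" by simp
      with H have "u \<notin> M" "v \<notin> M" by auto
      with z have "(z, u) \<in> ?G' \<union> H" by simp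
      with z(2) uv have "(x, v) \<in> (?G' \<union> H)\<^sup>*" by (meson UnCI rtrancl.rtrancl_into_rtrancl)
      with \<open>v \<notin> M\<close> show ?thesis by blast
    qed
  qed
  then obtain z where z: "z \<notin> M" "(x, z) \<in> (?G' \<union> H)\<^sup>*" "(z, y) \<in> G\<^sup>*" by blast
  with y have "(z, y) \<in> ?G' \<union> H" by simp
  with z(2) show "(x, y) \<in> (?G' \<union> H)\<^sup>*" by (rule rtrancl_into_rtrancl)
next
  have "?G' \<union> H \<subseteq> (G \<union> H)\<^sup>*" using rtrancl_mono[of G "G \<union> H"] by auto
  then have "(?G' \<union> H)\<^sup>* \<subseteq> (G \<union> H)\<^sup>*" by (metis rtrancl_idemp rtrancl_mono)
  then show "(x, y) \<in> (?G' \<union> H)\<^sup>* \<Longrightarrow> (x, y) \<in> (G \<union> H)\<^sup>*" by blast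
qed

lemma layer_fst:
  assumes "(p, q) \<in> layer i j \<alpha>" shows "fst p \<in> {i, j}" "fst q \<in> {i, j}"
proof -
  have "fst (lab i j z) \<in> {i, j}" for z by (cases z) auto
  then show "fst p \<in> {i, j}" "fst q \<in> {i, j}" using assms by (auto simp: layer_def)
qed

lemma layer_ends:
  assumes "(p, q) \<in> layer i j \<alpha>" "\<alpha> \<in> partition_cat a b"
  shows "p \<in> lab i j ` points a b" "q \<in> lab i j ` points a b"
  using assms edges_points[OF assms(2)] by (auto simp: layer_def)

lemma rtrancl_ends:
  assumes "(p, q) \<in> R\<^sup>*" "p \<noteq> q" "\<And>u v. (u, v) \<in> R \<Longrightarrow> u \<in> V \<and> v \<in> V"
  shows "p \<in> V \<and> q \<in> V"
  using assms by (metis converse_rtranclE rtranclE)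

text \<open>
  Inside a larger graph whose remaining edges avoid the middle layer \<open>j\<close>, a composite can be
  replaced by its factors.
\<close>

lemma layer_prod:
  assumes \<alpha>: "\<alpha> \<in> partition_cat a b" and \<beta>: "\<beta> \<in> partition_cat b c"
    and d: "i \<noteq> j" "j \<noteq> k" "i \<noteq> k"
    and H: "\<And>p q. (p, q) \<in> H \<Longrightarrow> fst p \<noteq> j \<and> fst q \<noteq> j" and pq: "fst p \<noteq> j" "fst q \<noteq> j"
  shows "(p, q) \<in> (layer i k (diagram_prod a c \<alpha> \<beta>) \<union> H)\<^sup>* \<longleftrightarrow>
         (p, q) \<in> (layer i j \<alpha> \<union> layer j k \<beta> \<union> H)\<^sup>*"
proof -
  let ?G = "layer i j \<alpha> \<union> layer j k \<beta>" and ?M = "{p. fst p = j}"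
  let ?L = "layer i k (diagram_prod a c \<alpha> \<beta>)"
  let ?G' = "?G\<^sup>* \<inter> (- ?M) \<times> (- ?M)"
  have 1: "?L \<subseteq> ?G'"
    using d by (fastforce simp: prod_layer[OF \<alpha> \<beta> d] layer_def elim: points_cases)
  \<comment> \<open>The identity accounts for points that are in neither diagram.\<close>
  have 2: "?G' \<subseteq> ?L \<union> Id"
  proof (intro subrelI)
    fix u v assume uv: "(u, v) \<in> ?G'"
    show "(u, v) \<in> ?L \<union> Id"
    proof (cases "u = v")
      case False
      let ?V = "lab i j ` points a b \<union> lab j k ` points b c"
      have "u \<in> ?V \<and> v \<in> ?V"
        using uv False layer_ends[OF _ \<alpha>] layer_ends[OF _ \<beta>] by (intro rtrancl_ends[of u v ?G]) blast+
      moreover have "w \<in> lab i k ` points a c" if "w \<in> ?V" "fst w \<noteq> j" for w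
      proof -
        from that(1) consider z where "z \<in> points a b" "w = lab i j z" | z where "z \<in> points b c" "w = lab j k z" by blast
        then show ?thesis
        proof cases
          case 1 then show ?thesis using that(2) by (cases z) (auto intro!: image_eqI[of _ _ "Plain _"])
        next
          case 2 then show ?thesis using that(2) by (cases z) (auto intro!: image_eqI[of _ _ "Prime _"])
        qed
      qed
      ultimately obtain x y where "x \<in> points a c" "y \<in> points a c" "u = lab i k x" "v = lab i k y"
        using uv by blast
      then have "(x, y) \<in> edges (diagram_prod a c \<alpha> \<beta>)"
        using uv by (auto simp: prod_layer[OF \<alpha> \<beta> d])
      then show ?thesis using \<open>u = _\<close> \<open>v = _\<close> by (auto simp: layer_def)
    qed simp
  qed
  have "(?L \<union> H)\<^sup>* = (?G' \<union> H)\<^sup>*"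
  proof
    show "(?L \<union> H)\<^sup>* \<subseteq> (?G' \<union> H)\<^sup>*" by (intro rtrancl_mono Un_mono 1 order_refl)
    have "?G' \<union> H \<subseteq> (?L \<union> H)\<^sup>*" using 2 by blast
    then show "(?G' \<union> H)\<^sup>* \<subseteq> (?L \<union> H)\<^sup>*" by (metis rtrancl_idemp rtrancl_mono)
  qed
  moreover have "(p, q) \<in> (?G \<union> H)\<^sup>* \<longleftrightarrow> (p, q) \<in> (?G' \<union> H)\<^sup>*"
    using H pq by (intro rtrancl_eliminate) auto
  ultimately show ?thesis by simp
qed

text \<open>
  Three composable diagrams drawn between the layers \<open>0\<close>, \<open>1\<close>, \<open>2\<close> and \<open>3\<close>.
\<close>

definition graph3 ::
    "diagram \<Rightarrow> diagram \<Rightarrow> diagram \<Rightarrow> ((nat \<times> nat) \<times> (nat \<times> nat)) set" where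
  "graph3 \<alpha> \<beta> \<gamma> = layer 0 1 \<alpha> \<union> layer 1 2 \<beta> \<union> layer 2 3 \<gamma>"

lemma prod3_left:
  assumes \<alpha>: "\<alpha> \<in> partition_cat a b" and \<beta>: "\<beta> \<in> partition_cat b c" and \<gamma>: "\<gamma> \<in> partition_cat c d"
  shows "(x, y) \<in> edges (diagram_prod a d (diagram_prod a c \<alpha> \<beta>) \<gamma>) \<longleftrightarrow>
     x \<in> points a d \<and> y \<in> points a d \<and> (lab 0 3 x, lab 0 3 y) \<in> (graph3 \<alpha> \<beta> \<gamma>)\<^sup>*"
proof -
  have "(lab 0 3 x, lab 0 3 y) \<in> (layer 0 2 (diagram_prod a c \<alpha> \<beta>) \<union> layer 2 3 \<gamma>)\<^sup>* \<longleftrightarrow>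
        (lab 0 3 x, lab 0 3 y) \<in> (graph3 \<alpha> \<beta> \<gamma>)\<^sup>*"
    if "x \<in> points a d" "y \<in> points a d"
    unfolding graph3_def
    by (rule layer_prod[OF \<alpha> \<beta>])
       (use that in \<open>auto dest: layer_fst elim!: points_cases\<close>)
  then show ?thesis by (auto simp: prod_layer[OF prod_in_cat \<gamma>, of 0 2 3])
qed

lemma prod3_right:
  assumes \<alpha>: "\<alpha> \<in> partition_cat a b" and \<beta>: "\<beta> \<in> partition_cat b c" and \<gamma>: "\<gamma> \<in> partition_cat c d"
  shows "(x, y) \<in> edges (diagram_prod a d \<alpha> (diagram_prod b d \<beta> \<gamma>)) \<longleftrightarrow>
     x \<in> points a d \<and> y \<in> points a d \<and> (lab 0 3 x, lab 0 3 y) \<in> (graph3 \<alpha> \<beta> \<gamma>)\<^sup>*"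
proof -
  have "(lab 0 3 x, lab 0 3 y) \<in> (layer 1 3 (diagram_prod b d \<beta> \<gamma>) \<union> layer 0 1 \<alpha>)\<^sup>* \<longleftrightarrow>
        (lab 0 3 x, lab 0 3 y) \<in> (layer 1 2 \<beta> \<union> layer 2 3 \<gamma> \<union> layer 0 1 \<alpha>)\<^sup>*"
    if "x \<in> points a d" "y \<in> points a d"
    by (rule layer_prod[OF \<beta> \<gamma>])
       (use that in \<open>auto dest: layer_fst elim!: points_cases\<close>)
  then show ?thesis
    by (auto simp: prod_layer[OF \<alpha> prod_in_cat, of 0 1 3] graph3_def Un_ac)
qed

lemma diagram_prod_assoc:
  assumes "\<alpha> \<in> partition_cat a b" "\<beta> \<in> partition_cat b c" "\<gamma> \<in> partition_cat c d"
  shows "diagram_prod a d (diagram_prod a c \<alpha> \<beta>) \<gamma> = diagram_prod a d \<alpha> (diagram_prod b d \<beta> \<gamma>)"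
  by (rule diagram_eqI[OF prod_in_cat prod_in_cat])
     (auto simp: prod3_left[OF assms] prod3_right[OF assms])

section \<open>Reflection of diagrams\<close>

text \<open>
  Diagrams whose block sizes lie in \<open>s\<close>.  The three categories are the cases where \<open>s\<close> is
  \<open>UNIV\<close>, \<open>{1, 2}\<close> and \<open>{2}\<close>.
\<close>

definition sized_cat :: "nat set \<Rightarrow> nat \<Rightarrow> nat \<Rightarrow> diagram set" where
  "sized_cat s m n = {\<alpha> \<in> partition_cat m n. \<forall>A\<in>\<alpha>. card A \<in> s}"

lemma sized_cat_partition: "\<alpha> \<in> sized_cat s m n \<Longrightarrow> \<alpha> \<in> partition_cat m n"
  by (simp add: sized_cat_def)

text \<open>
  The reflection that exchanges the upper and the lower points, on points and on diagrams.
\<close>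

fun swap :: "point \<Rightarrow> point" where
  "swap (Plain x) = Prime x"
| "swap (Prime x) = Plain x"
| "swap (DPrime x) = DPrime x"

definition flip :: "diagram \<Rightarrow> diagram" where
  "flip \<alpha> = (`) swap ` \<alpha>"

lemma swap_swap [simp]: "swap (swap x) = x"
  by (cases x) auto

lemma bij_swap: "bij swap"
  by (rule o_bij[of swap]) auto

lemma inj_swap: "inj_on swap A"
  using bij_swap by (meson bij_is_inj inj_on_subset subset_UNIV)

lemma swap_in_points [simp]: "swap x \<in> points m n \<longleftrightarrow> x \<in> points n m"
  by (cases x) auto

lemma swap_in_image [simp]: "x \<in> swap ` A \<longleftrightarrow> swap x \<in> A"
  by (metis image_iff swap_swap)

lemma swap_points: "swap ` points m n = points n m"
  by (simp only: set_eq_iff swap_in_image swap_in_points) simp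

lemma partition_on_image:
  assumes "partition_on A P" "inj_on f A"
  shows "partition_on (f ` A) ((`) f ` P)"
proof -
  have "(`) f ` P - {{}} = (`) f ` P" using partition_onD3[OF assms(1)] by auto
  then show ?thesis using partition_on_inj_image[OF assms] by simp
qed

lemma flip_in_sized_cat: "\<alpha> \<in> sized_cat s m n \<Longrightarrow> flip \<alpha> \<in> sized_cat s n m"
  unfolding sized_cat_def partition_cat_def
  using partition_on_image[of "points m n" \<alpha> swap] inj_swap
  by (auto simp: flip_def swap_points card_image)

lemma flip_in_partition_cat: "\<alpha> \<in> partition_cat m n \<Longrightarrow> flip \<alpha> \<in> partition_cat n m"
  using flip_in_sized_cat[of \<alpha> UNIV m n] by (simp add: sized_cat_def)

lemma edges_flip: "(x, y) \<in> edges (flip \<alpha>) \<longleftrightarrow> (swap x, swap y) \<in> edges \<alpha>"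
  by (simp add: edges_iff flip_def)

lemma layer_flip:
  assumes "\<alpha> \<in> partition_cat a b"
  shows "layer i j (flip \<alpha>) = layer j i \<alpha>"
proof -
  have lab_swap: "lab i j (swap x) = lab j i x" if "x \<in> points a b" for x i j
    using that by (cases x) auto
  have "layer i j (flip \<alpha>) = map_prod (lab i j) (lab i j) ` map_prod swap swap ` edges \<alpha>"
  proof -
    have "edges (flip \<alpha>) = map_prod swap swap ` edges \<alpha>"
      by (force simp: edges_flip image_iff intro: bexI[of _ "(swap _, swap _)"])
    then show ?thesis by (simp add: layer_def)
  qed
  also have "\<dots> = layer j i \<alpha>"
    unfolding layer_def image_image
    using edges_points[OF assms] by (intro image_cong refl) (auto simp: lab_swap)
  finally show ?thesis .
qed

lemma flip_prod:
  assumes \<alpha>: "\<alpha> \<in> partition_cat a b" and \<beta>: "\<beta> \<in> partition_cat b c"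
  shows "flip (diagram_prod a c \<alpha> \<beta>) = diagram_prod c a (flip \<beta>) (flip \<alpha>)"
proof (rule diagram_eqI[of _ c a])
  show "edges (flip (diagram_prod a c \<alpha> \<beta>)) = edges (diagram_prod c a (flip \<beta>) (flip \<alpha>))"
  proof (intro Set.set_eqI)
    fix p :: "point \<times> point"
    obtain x y where p: "p = (x, y)" by (cases p)
    have "lab 0 2 (swap z) = lab 2 0 z" if "z \<in> points c a" for z
      using that by (cases z) auto
    then show "p \<in> edges (flip (diagram_prod a c \<alpha> \<beta>)) \<longleftrightarrow> p \<in> edges (diagram_prod c a (flip \<beta>) (flip \<alpha>))"
      unfolding p edges_flip
      by (auto simp: prod_layer[OF \<alpha> \<beta>, of 0 1 2]
          prod_layer[OF flip_in_partition_cat[OF \<beta>] flip_in_partition_cat[OF \<alpha>], of 2 1 0]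
          layer_flip[OF \<alpha>] layer_flip[OF \<beta>] Un_commute)
  qed
qed (simp_all add: flip_in_partition_cat)

section \<open>Transversals and rank\<close>

text \<open>
  The transversals of a diagram: the blocks that meet both rows of points.  They are counted by the
  rank.
\<close>

definition through :: "diagram \<Rightarrow> diagram" where
  "through \<alpha> = {A \<in> \<alpha>. A \<inter> range Plain \<noteq> {} \<and> A \<inter> range Prime \<noteq> {}}"

lemma rank_through: "rank \<alpha> = card (through \<alpha>)"
  by (simp add: rank_def through_def)

lemma through_iff: "A \<in> through \<alpha> \<longleftrightarrow> A \<in> \<alpha> \<and> (\<exists>x. Plain x \<in> A) \<and> (\<exists>y. Prime y \<in> A)"
  by (auto simp: through_def)

lemma through_edge:
  "(Plain x, Prime y) \<in> edges \<alpha> \<longleftrightarrow> (\<exists>A\<in>through \<alpha>. Plain x \<in> A \<and> Prime y \<in> A)"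
  unfolding edges_iff Bex_def through_iff by blast

lemma finite_through: "\<alpha> \<in> partition_cat m n \<Longrightarrow> finite (through \<alpha>)"
  using finite_diagram by (auto simp: through_def)

lemma through_flip: "through (flip \<alpha>) = (`) swap ` through \<alpha>"
proof -
  have meets: "B \<inter> range Plain \<noteq> {} \<longleftrightarrow> (\<exists>x. Plain x \<in> B)"
    "B \<inter> range Prime \<noteq> {} \<longleftrightarrow> (\<exists>x. Prime x \<in> B)" for B
    by blast+
  have up: "swap ` A \<inter> range Plain \<noteq> {} \<longleftrightarrow> A \<inter> range Prime \<noteq> {}"
    and low: "swap ` A \<inter> range Prime \<noteq> {} \<longleftrightarrow> A \<inter> range Plain \<noteq> {}" for A
    by (simp_all only: meets swap_in_image swap.simps)
  show ?thesis
    unfolding through_def flip_def Compr_image_eq up low by (simp only: conj_commute)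
qed

lemma rank_flip: "rank (flip \<alpha>) = rank \<alpha>"
proof -
  have "inj_on ((`) swap) (through \<alpha>)"
    by (meson inj_image_eq_iff inj_on_def inj_swap)
  then show ?thesis by (simp add: rank_through through_flip card_image)
qed

lemma rank_ge:
  assumes "\<alpha> \<in> partition_cat m n"
    and "\<And>j. j \<in> J \<Longrightarrow> (Plain (u j), Prime (v j)) \<in> edges \<alpha>"
    and "\<And>i j. i \<in> J \<Longrightarrow> j \<in> J \<Longrightarrow> (Plain (u i), Plain (u j)) \<in> edges \<alpha> \<Longrightarrow> i = j"
  shows "card J \<le> rank \<alpha>"
  unfolding rank_through
proof (rule card_le_if_inj_on_rel[where r = "\<lambda>j A. Plain (u j) \<in> A"])
  show "finite (through \<alpha>)" by (rule finite_through[OF assms(1)])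
  show "\<exists>A. A \<in> through \<alpha> \<and> Plain (u j) \<in> A" if "j \<in> J" for j
    using assms(2)[OF that] by (auto simp: through_edge)
  show "i = j" if "i \<in> J" "j \<in> J" "A \<in> through \<alpha>" "Plain (u i) \<in> A" "Plain (u j) \<in> A" for i j A
    using that assms(3) by (auto simp: edges_iff through_iff)
qed

lemma rank_le_upper:
  assumes "\<alpha> \<in> partition_cat m n" shows "rank \<alpha> \<le> m"
proof -
  have "card (through \<alpha>) \<le> card {1..m}"
  proof (rule card_le_if_inj_on_rel[where r = "\<lambda>A x. Plain x \<in> A"])
    show "\<exists>x. x \<in> {1..m} \<and> Plain x \<in> A" if "A \<in> through \<alpha>" for A
      using that block_subset[OF assms, of A] points_simps(1)[of _ m n] by (auto simp: through_iff simp del: points_simps)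
    show "A = B" if "A \<in> through \<alpha>" "B \<in> through \<alpha>" "Plain x \<in> A" "Plain x \<in> B" for A B x
      using that block_eq[OF assms] by (auto simp: through_iff)
  qed simp
  then show ?thesis by (simp add: rank_through)
qed

lemma rank_le_lower:
  assumes "\<alpha> \<in> partition_cat m n" shows "rank \<alpha> \<le> n"
  using rank_le_upper[OF flip_in_partition_cat[OF assms]] by (simp add: rank_flip)

text \<open>
  If the rank equals the number of upper points, then every upper point lies in a transversal of its
  own.
\<close>

lemma full_rank:
  assumes \<alpha>: "\<alpha> \<in> partition_cat m n" and r: "rank \<alpha> = m"
  shows "(Plain x, Plain x') \<in> edges \<alpha> \<Longrightarrow> x = x'"
    and "x \<in> {1..m} \<Longrightarrow> \<exists>y. (Plain x, Prime y) \<in> edges \<alpha>"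
proof -
  \<comment> \<open>Choosing an upper point in each transversal is injective, hence onto by counting.\<close>
  have "\<forall>A\<in>through \<alpha>. \<exists>x. Plain x \<in> A" by (auto simp: through_iff)
  then obtain g where g: "\<And>A. A \<in> through \<alpha> \<Longrightarrow> Plain (g A) \<in> A" by metis
  have inj: "inj_on g (through \<alpha>)"
    using g block_eq[OF \<alpha>] by (metis inj_onI through_iff)
  have "g ` through \<alpha> \<subseteq> {1..m}"
  proof (rule image_subsetI)
    fix A assume "A \<in> through \<alpha>"
    then have "Plain (g A) \<in> A" "A \<in> \<alpha>" using g[of A] by (simp_all add: through_iff)
    then have "Plain (g A) \<in> points m n" using block_subset[OF \<alpha>] by blast
    then show "g A \<in> {1..m}" by simp
  qed
  moreover have "card (g ` through \<alpha>) = card {1..m}"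
    using r inj by (simp add: rank_through card_image)
  ultimately have img: "g ` through \<alpha> = {1..m}" by (intro card_subset_eq) auto
  show "\<exists>y. (Plain x, Prime y) \<in> edges \<alpha>" if "x \<in> {1..m}"
  proof -
    obtain A where A: "A \<in> through \<alpha>" "x = g A"
      using \<open>x \<in> {1..m}\<close> unfolding img[symmetric] by (rule imageE)
    have "A \<in> \<alpha>" "\<exists>y. Prime y \<in> A" using A(1) by (simp_all add: through_iff)
    moreover have "Plain x \<in> A" using g[OF A(1)] by (simp only: A(2))
    ultimately show ?thesis unfolding edges_iff by blast
  qed
  show "x = x'" if e: "(Plain x, Plain x') \<in> edges \<alpha>"
  proof -
    have "x \<in> g ` through \<alpha>" "x' \<in> g ` through \<alpha>"
      using edges_points[OF \<alpha> e] by (simp_all add: img)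
    then obtain A B where AB: "A \<in> through \<alpha>" "x = g A" "B \<in> through \<alpha>" "x' = g B"
      by (elim imageE)
    obtain C where C: "C \<in> \<alpha>" "Plain x \<in> C" "Plain x' \<in> C" using e by (auto simp: edges_iff)
    have "A = C" "B = C" using AB C g block_eq[OF \<alpha>] by (metis through_iff)+
    then show ?thesis using AB by simp
  qed
qed

lemma edges_prod_upper:
  assumes \<alpha>: "\<alpha> \<in> partition_cat a b" and "\<beta> \<in> partition_cat b c"
    and e: "(Plain x, Plain y) \<in> edges \<alpha>"
  shows "(Plain x, Plain y) \<in> edges (diagram_prod a c \<alpha> \<beta>)"
proof -
  have "(lab 0 1 (Plain x), lab 0 1 (Plain y)) \<in> layer 0 1 \<alpha>"
    using e by (force simp: layer_def)
  then show ?thesis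
    using edges_points[OF \<alpha> e] by (auto simp: prod_layer[OF assms(1,2), of 0 1 2])
qed

text \<open>
  A path from an upper to a lower point of a composite crosses the first factor through one of its
  transversals; this is why the rank of a composite is at most that of its first factor.
\<close>

lemma edges_prod_through:
  assumes \<alpha>: "\<alpha> \<in> partition_cat a b" and \<beta>: "\<beta> \<in> partition_cat b c"
    and e: "(Plain x, Prime y) \<in> edges (diagram_prod a c \<alpha> \<beta>)"
  shows "\<exists>u v. (Plain u, Prime v) \<in> edges \<alpha> \<and> (Plain x, Plain u) \<in> edges (diagram_prod a c \<alpha> \<beta>)"
proof (rule ccontr)
  assume neg: "\<not> ?thesis"
  let ?R = "layer 0 1 \<alpha> \<union> layer 1 2 \<beta>"
  note pl = prod_layer[OF \<alpha> \<beta>, of 0 1 2]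
  have x: "x \<in> {1..a}" using edges_points[OF prod_in_cat e] by simp
  \<comment> \<open>Under the negation, no path from the upper point \<open>x\<close> leaves the top layer.\<close>
  have "fst w = 0" if "((0, x), w) \<in> ?R\<^sup>*" for w
    using that
  proof (induction rule: rtrancl_induct)
    case (step w w')
    then have "(w, w') \<in> layer 0 1 \<alpha>" using layer_fst[of w w' 1 2 \<beta>] by auto
    then obtain z z' where z: "(z, z') \<in> edges \<alpha>" "w = lab 0 1 z" "w' = lab 0 1 z'"
      by (auto simp: layer_def)
    have pts: "z \<in> points a b" "z' \<in> points a b" using edges_points[OF \<alpha> z(1)] by auto
    with step.IH z(2) obtain u where u: "z = Plain u" "u \<in> {1..a}" "w = (0, u)" by (auto elim: points_cases)
    have "(Plain x, Plain u) \<in> edges (diagram_prod a c \<alpha> \<beta>)"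
      using step.hyps(1) u x by (simp add: pl)
    with neg have "z' \<noteq> Prime v" for v using z(1) u(1) by blast
    then show ?case using pts(2) z(3) by (cases z') auto
  qed simp
  from this[of "(2, y)"] show False using e by (simp add: pl)
qed

lemma rank_prod_left:
  assumes \<alpha>: "\<alpha> \<in> partition_cat a b" and \<beta>: "\<beta> \<in> partition_cat b c"
  shows "rank (diagram_prod a c \<alpha> \<beta>) \<le> rank \<alpha>"
  unfolding rank_through
proof (rule card_le_if_inj_on_rel[where r = "\<lambda>X A. \<exists>u. Plain u \<in> X \<and> Plain u \<in> A"])
  let ?P = "diagram_prod a c \<alpha> \<beta>"
  show "finite (through \<alpha>)" by (rule finite_through[OF \<alpha>])
  show "\<exists>A. A \<in> through \<alpha> \<and> (\<exists>u. Plain u \<in> X \<and> Plain u \<in> A)" if X: "X \<in> through ?P" for X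
  proof -
    obtain x y where xy: "X \<in> ?P" "Plain x \<in> X" "Prime y \<in> X" using X unfolding through_iff by blast
    then have "(Plain x, Prime y) \<in> edges ?P" by (auto simp: edges_iff)
    then obtain u v where "(Plain u, Prime v) \<in> edges \<alpha>" "(Plain x, Plain u) \<in> edges ?P"
      using edges_prod_through[OF \<alpha> \<beta>] by blast
    then show ?thesis using xy block_of_edge[OF prod_in_cat] by (auto simp: through_edge)
  qed
  show "X = Y" if XY: "X \<in> through ?P" "Y \<in> through ?P" "A \<in> through \<alpha>"
    and u: "\<exists>u. Plain u \<in> X \<and> Plain u \<in> A" "\<exists>u. Plain u \<in> Y \<and> Plain u \<in> A" for X Y A
  proof -
    obtain u v where uv: "Plain u \<in> X" "Plain u \<in> A" "Plain v \<in> Y" "Plain v \<in> A" using u by blast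
    then have "(Plain u, Plain v) \<in> edges \<alpha>" using XY(3) by (auto simp: through_iff edges_iff)
    then have "(Plain u, Plain v) \<in> edges ?P" by (rule edges_prod_upper[OF \<alpha> \<beta>])
    then have "Plain v \<in> X" using XY(1) uv(1) block_of_edge[OF prod_in_cat] by (auto simp: through_iff)
    then show ?thesis using XY uv block_eq[OF prod_in_cat] by (metis through_iff)
  qed
qed

lemma rank_prod_right:
  assumes \<alpha>: "\<alpha> \<in> partition_cat a b" and \<beta>: "\<beta> \<in> partition_cat b c"
  shows "rank (diagram_prod a c \<alpha> \<beta>) \<le> rank \<beta>"
  using rank_prod_left[OF flip_in_partition_cat[OF \<beta>] flip_in_partition_cat[OF \<alpha>]]
  by (simp add: rank_flip flip: flip_prod[OF \<alpha> \<beta>])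

section \<open>Permutation diagrams\<close>

text \<open>
  The diagram of a permutation \<open>p\<close> joins \<open>p i\<close> in the upper row to \<open>i\<close> in the lower row.  With this
  orientation composition of diagrams corresponds to composition of functions.
\<close>

definition perm_diagram :: "nat \<Rightarrow> (nat \<Rightarrow> nat) \<Rightarrow> diagram" where
  "perm_diagram n p = (\<lambda>i. {Plain (p i), Prime i}) ` {1..n}"

lemma edges_perm_diagram:
  "(Plain x, Prime y) \<in> edges (perm_diagram n p) \<longleftrightarrow> x = p y \<and> y \<in> {1..n}"
  "(Prime y, Plain x) \<in> edges (perm_diagram n p) \<longleftrightarrow> x = p y \<and> y \<in> {1..n}"
  "(Plain x, Plain x') \<in> edges (perm_diagram n p) \<longleftrightarrow> x = x' \<and> x \<in> p ` {1..n}"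
  "(Prime y, Prime y') \<in> edges (perm_diagram n p) \<longleftrightarrow> y = y' \<and> y \<in> {1..n}"
  unfolding perm_diagram_def edges_iff by blast+

lemma perm_diagram_in_sized_cat:
  assumes "p permutes {1..n}" "2 \<in> s"
  shows "perm_diagram n p \<in> sized_cat s n n"
proof -
  have inj: "inj p" using assms(1) by (simp add: permutes_inj)
  have "\<Union> (perm_diagram n p) = Plain ` p ` {1..n} \<union> Prime ` {1..n}"
    by (auto simp: perm_diagram_def)
  also have "\<dots> = points n n" using assms(1) by (simp add: permutes_image points_def)
  finally have "partition_on (points n n) (perm_diagram n p)"
    using injD[OF inj] by (intro partition_onI) (auto simp: perm_diagram_def disjnt_def)
  then show ?thesis using assms(2) by (auto simp: sized_cat_def partition_cat_def perm_diagram_def numeral_2_eq_2)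
qed

lemma perm_diagram_in_partition_cat:
  "p permutes {1..n} \<Longrightarrow> perm_diagram n p \<in> partition_cat n n"
  using perm_diagram_in_sized_cat[of p n UNIV] by (simp add: sized_cat_def)

lemma perm_diagram_inj:
  assumes "p permutes {1..n}" "q permutes {1..n}" "perm_diagram n p = perm_diagram n q"
  shows "p = q"
proof
  fix y
  show "p y = q y"
  proof (cases "y \<in> {1..n}")
    case True
    then have "(Plain (p y), Prime y) \<in> edges (perm_diagram n p)" by (simp add: edges_perm_diagram)
    then show ?thesis using assms(3) by (simp add: edges_perm_diagram)
  next
    case False
    then show ?thesis using assms(1,2) by (simp add: permutes_def)
  qed
qed

lemma rank_perm_diagram:
  assumes "p permutes {1..n}" shows "rank (perm_diagram n p) = n"
proof (rule antisym)
  note P = perm_diagram_in_partition_cat[OF assms]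
  show "rank (perm_diagram n p) \<le> n" by (rule rank_le_upper[OF P])
  have "card {1..n} \<le> rank (perm_diagram n p)"
    by (rule rank_ge[OF P, of _ p "\<lambda>i. i"])
       (use permutes_inj[OF assms] in \<open>auto simp: edges_perm_diagram dest: injD\<close>)
  then show "n \<le> rank (perm_diagram n p)" by simp
qed

lemma full_rank_square:
  assumes \<alpha>: "\<alpha> \<in> partition_cat n n" and r: "rank \<alpha> = n"
  shows "\<exists>p. p permutes {1..n} \<and> \<alpha> = perm_diagram n p"
proof -
  note up = full_rank[OF \<alpha> r]
  have low: "y = y'" if "(Prime y, Prime y') \<in> edges \<alpha>" for y y'
    using full_rank(1)[OF flip_in_partition_cat[OF \<alpha>]] r that by (simp add: rank_flip edges_flip)
  have low': "\<exists>x. (Plain x, Prime y) \<in> edges \<alpha>" if "y \<in> {1..n}" for y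
    using full_rank(2)[OF flip_in_partition_cat[OF \<alpha>]] r that edges_sym
    by (fastforce simp: rank_flip edges_flip)
  define p where "p y = (if y \<in> {1..n} then SOME x. (Plain x, Prime y) \<in> edges \<alpha> else y)" for y
  have p: "(Plain (p y), Prime y) \<in> edges \<alpha>" if "y \<in> {1..n}" for y
    using someI_ex[OF low'[OF that]] that by (simp add: p_def)
  have range: "p ` {1..n} \<subseteq> {1..n}"
    using edges_points(1)[OF \<alpha> p] by auto
  have inj: "inj_on p {1..n}"
  proof (rule inj_onI)
    fix y y' assume y: "y \<in> {1..n}" "y' \<in> {1..n}" "p y = p y'"
    have "(Prime y, Prime y') \<in> edges \<alpha>"
      using edges_trans[OF \<alpha> edges_sym[OF p[OF y(1)]]] p[OF y(2)] y(3) by simp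
    then show "y = y'" by (rule low)
  qed
  have img: "p ` {1..n} = {1..n}"
    using range inj by (simp add: endo_inj_surj)
  have perm: "p permutes {1..n}"
    by (rule bij_imp_permutes) (use inj img in \<open>auto simp: bij_betw_def p_def\<close>)
  have plain_prime: "(Plain x, Prime y) \<in> edges \<alpha> \<longleftrightarrow> x = p y \<and> y \<in> {1..n}" for x y
  proof
    assume e: "(Plain x, Prime y) \<in> edges \<alpha>"
    then have y: "y \<in> {1..n}" using edges_points(2)[OF \<alpha>] by fastforce
    have "(Plain x, Plain (p y)) \<in> edges \<alpha>" using edges_trans[OF \<alpha> e edges_sym[OF p[OF y]]] .
    then show "x = p y \<and> y \<in> {1..n}" using up(1) y by blast
  qed (use p in blast)
  have "edges \<alpha> = edges (perm_diagram n p)"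
  proof (intro Set.set_eqI)
    fix e :: "point \<times> point"
    obtain x y where e: "e = (x, y)" by (cases e)
    have dp: "(u, v) \<notin> edges \<gamma>" if "\<gamma> \<in> partition_cat n n" "u \<in> range DPrime \<or> v \<in> range DPrime" for u v \<gamma>
      using edges_points[OF that(1), of u v] that(2) by auto
    note P = perm_diagram_in_partition_cat[OF perm]
    have up': "(Plain x, Plain x') \<in> edges \<alpha> \<longleftrightarrow> x = x' \<and> x \<in> {1..n}" for x x'
      using up(1) edges_refl[OF \<alpha>] edges_points(1)[OF \<alpha>] by fastforce
    have low'': "(Prime y, Prime y') \<in> edges \<alpha> \<longleftrightarrow> y = y' \<and> y \<in> {1..n}" for y y'
      using low edges_refl[OF \<alpha>] edges_points(1)[OF \<alpha>] by fastforce
    have prime_plain: "(Prime y, Plain x) \<in> edges \<alpha> \<longleftrightarrow> x = p y \<and> y \<in> {1..n}" for x y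
      using plain_prime edges_sym by metis
    show "e \<in> edges \<alpha> \<longleftrightarrow> e \<in> edges (perm_diagram n p)"
      unfolding e
      by (cases x; cases y)
         (simp_all add: edges_perm_diagram plain_prime prime_plain up' low'' img dp[OF \<alpha>] dp[OF P] del: One_nat_def)
  qed
  then have "\<alpha> = perm_diagram n p"
    by (rule diagram_eqI[OF \<alpha> perm_diagram_in_partition_cat[OF perm]])
  with perm show ?thesis by blast
qed

text \<open>
  Relabelling of the lower points along \<open>p\<close>.  Multiplying a diagram on the right by the diagram of
  \<open>p\<close> renames its lower points along the inverse of \<open>p\<close>.
\<close>

fun rename_lower :: "(nat \<Rightarrow> nat) \<Rightarrow> point \<Rightarrow> point" where
  "rename_lower p (Plain x) = Plain x"
| "rename_lower p (Prime x) = Prime (p x)"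
| "rename_lower p (DPrime x) = DPrime x"

lemma rename_lower_inv:
  assumes "bij p"
  shows "rename_lower p (rename_lower (inv_into UNIV p) x) = x" "rename_lower (inv_into UNIV p) (rename_lower p x) = x"
  using assms by (cases x; simp add: bij_is_surj surj_f_inv_f bij_is_inj)+

lemma rename_lower_points:
  assumes "p permutes {1..n}" shows "rename_lower p x \<in> points m n \<longleftrightarrow> x \<in> points m n"
  using permutes_in_image[OF assms] by (cases x) auto

lemma edges_prod_perm:
  assumes \<alpha>: "\<alpha> \<in> partition_cat m n" and p: "p permutes {1..n}"
  shows "(x, y) \<in> edges (diagram_prod m n \<alpha> (perm_diagram n p)) \<longleftrightarrow>
         (rename_lower p x, rename_lower p y) \<in> edges \<alpha>"
proof
  let ?R = "layer 0 1 \<alpha> \<union> layer 1 2 (perm_diagram n p)"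
  note P = perm_diagram_in_partition_cat[OF p]
  note pl = prod_layer[OF \<alpha> P, of 0 1 2]
  \<comment> \<open>Each vertex of the three layers is sent to the point of \<open>\<alpha>\<close> to which it is connected.\<close>
  define c where "c = (\<lambda>(i::nat, x). if i = 0 then Plain x else if i = 1 then Prime x else Prime (p x))"
  have c02: "c (lab 0 2 z) = rename_lower p z" if "z \<in> points m n" for z
    using that by (cases z) (auto simp: c_def)
  have c01: "c (lab 0 1 z) = z" if "z \<in> points m n" for z
    using that by (cases z) (auto simp: c_def)
  have c12: "c (lab 1 2 z) = c (lab 1 2 z')" if "(z, z') \<in> edges (perm_diagram n p)" for z z'
    using that edges_points[OF P that] by (cases z; cases z') (auto simp: c_def edges_perm_diagram)
  {
    assume "(x, y) \<in> edges (diagram_prod m n \<alpha> (perm_diagram n p))"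
    then have x: "x \<in> points m n" and y: "y \<in> points m n" and path: "(lab 0 2 x, lab 0 2 y) \<in> ?R\<^sup>*"
      by (auto simp: pl)
    from path have "(c (lab 0 2 x), c (lab 0 2 y)) \<in> edges \<alpha>"
    proof (induction rule: rtrancl_induct)
      case base
      then show ?case using edges_refl[OF \<alpha>] x by (simp add: c02 rename_lower_points[OF p])
    next
      case (step u v)
      from step.hyps(2) show ?case
      proof
        assume "(u, v) \<in> layer 0 1 \<alpha>"
        then obtain z z' where "(z, z') \<in> edges \<alpha>" "u = lab 0 1 z" "v = lab 0 1 z'"
          by (auto simp: layer_def)
        then have "(c u, c v) \<in> edges \<alpha>" using c01 edges_points[OF \<alpha>] by auto
        with step.IH show ?thesis by (rule edges_trans[OF \<alpha>])
      next
        assume "(u, v) \<in> layer 1 2 (perm_diagram n p)"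
        then have "c u = c v" using c12 by (auto simp: layer_def)
        with step.IH show ?thesis by simp
      qed
    qed
    then show "(rename_lower p x, rename_lower p y) \<in> edges \<alpha>" using x y by (simp add: c02)
  }
  {
    assume e: "(rename_lower p x, rename_lower p y) \<in> edges \<alpha>"
    then have x: "x \<in> points m n" and y: "y \<in> points m n"
      using edges_points[OF \<alpha> e] rename_lower_points[OF p] by auto
    have 1: "(lab 0 2 z, lab 0 1 (rename_lower p z)) \<in> ?R\<^sup>* \<and> (lab 0 1 (rename_lower p z), lab 0 2 z) \<in> ?R\<^sup>*"
      if z: "z \<in> points m n" for z
    proof (cases z)
      case (Prime j)
      then have "(Plain (p j), Prime j) \<in> edges (perm_diagram n p)" "(Prime j, Plain (p j)) \<in> edges (perm_diagram n p)"
        using z by (simp_all add: edges_perm_diagram)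
      then have "(lab 1 2 (Plain (p j)), lab 1 2 (Prime j)) \<in> ?R" "(lab 1 2 (Prime j), lab 1 2 (Plain (p j))) \<in> ?R"
        unfolding layer_def by blast+
      then show ?thesis using Prime by auto
    qed (use z in auto)
    have "(lab 0 1 (rename_lower p x), lab 0 1 (rename_lower p y)) \<in> ?R"
      using e unfolding layer_def by blast
    with 1[OF x] 1[OF y] have "(lab 0 2 x, lab 0 2 y) \<in> ?R\<^sup>*"
      by (meson r_into_rtrancl rtrancl_trans)
    then show "(x, y) \<in> edges (diagram_prod m n \<alpha> (perm_diagram n p))" using x y by (simp add: pl)
  }
qed

lemma prod_perm_in_sized_cat:
  assumes \<alpha>: "\<alpha> \<in> sized_cat s m n" and p: "p permutes {1..n}"
  shows "diagram_prod m n \<alpha> (perm_diagram n p) \<in> sized_cat s m n"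
proof -
  let ?f = "rename_lower (inv_into UNIV p)" and ?\<beta> = "(`) (rename_lower (inv_into UNIV p)) ` \<alpha>"
  note bij = permutes_bij[OF p] and ip = permutes_inv[OF p]
  have inj: "inj_on ?f A" for A by (metis inj_onI rename_lower_inv(1)[OF bij])
  have "?f ` points m n = points m n"
    using rename_lower_points[OF ip] rename_lower_points[OF p] rename_lower_inv[OF bij]
    by (metis (no_types, lifting) image_iff set_eq_iff)
  then have \<beta>: "?\<beta> \<in> sized_cat s m n"
    using \<alpha> partition_on_image[of "points m n" \<alpha> ?f] inj
    by (auto simp: sized_cat_def partition_cat_def card_image)
  have mem: "x \<in> ?f ` A \<longleftrightarrow> rename_lower p x \<in> A" for x A
    by (metis image_iff rename_lower_inv[OF bij])
  have "diagram_prod m n \<alpha> (perm_diagram n p) = ?\<beta>"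
  proof (rule diagram_eqI[OF prod_in_cat sized_cat_partition[OF \<beta>]])
    have "(x, y) \<in> edges ?\<beta> \<longleftrightarrow> (rename_lower p x, rename_lower p y) \<in> edges \<alpha>" for x y
      by (simp add: edges_iff mem)
    then show "edges (diagram_prod m n \<alpha> (perm_diagram n p)) = edges ?\<beta>"
      by (auto simp: edges_prod_perm[OF sized_cat_partition[OF \<alpha>] p])
  qed
  with \<beta> show ?thesis by simp
qed

lemma prod_perm_id:
  assumes \<alpha>: "\<alpha> \<in> partition_cat m n"
  shows "diagram_prod m n \<alpha> (perm_diagram n id) = \<alpha>"
proof (rule diagram_eqI[OF prod_in_cat \<alpha>])
  have "rename_lower id x = x" for x by (cases x) auto
  then show "edges (diagram_prod m n \<alpha> (perm_diagram n id)) = edges \<alpha>"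
    by (auto simp: edges_prod_perm[OF \<alpha> permutes_id])
qed

lemma prod_perm_perm:
  assumes p: "p permutes {1..n}" and q: "q permutes {1..n}"
  shows "diagram_prod n n (perm_diagram n p) (perm_diagram n q) = perm_diagram n (p \<circ> q)"
proof (rule diagram_eqI[OF prod_in_cat])
  note pq = permutes_compose[OF q p]
  show PQ: "perm_diagram n (p \<circ> q) \<in> partition_cat n n" by (rule perm_diagram_in_partition_cat[OF pq])
  note P = perm_diagram_in_partition_cat[OF p]
  have "(rename_lower q x, rename_lower q y) \<in> edges (perm_diagram n p) \<longleftrightarrow>
        (x, y) \<in> edges (perm_diagram n (p \<circ> q))" for x y
  proof (cases "x \<in> points n n \<and> y \<in> points n n")
    case True
    then show ?thesis
      using inj_eq[OF permutes_inj[OF q]] permutes_in_image[OF q]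
      by (cases x; cases y)
         (auto simp: edges_perm_diagram permutes_image[OF p] permutes_image[OF pq, unfolded comp_def] simp del: One_nat_def)
  next
    case False
    then show ?thesis using edges_points[OF P] edges_points[OF PQ] rename_lower_points[OF q] by blast
  qed
  then show "edges (diagram_prod n n (perm_diagram n p) (perm_diagram n q)) = edges (perm_diagram n (p \<circ> q))"
    by (auto simp: edges_prod_perm[OF P q])
qed

section \<open>Extending families of blocks to diagrams\<close>

lemma pairing_exists:
  assumes "finite L" "even (card L)"
  shows "\<exists>N. partition_on L N \<and> (\<forall>A\<in>N. card A = 2)"
  using assms
proof (induction "card L" arbitrary: L rule: less_induct)
  case less
  show ?case
  proof (cases "L = {}")
    case True
    then show ?thesis by (intro exI[of _ "{}"]) (simp add: partition_on_def disjoint_def)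
  next
    case False
    then obtain x where x: "x \<in> L" by blast
    have "L \<noteq> {x}" using less.prems(2) by auto
    then obtain y where y: "y \<in> L" "y \<noteq> x" using x by blast
    have c: "card L = card (L - {x, y}) + 2"
      using card_Diff_subset[of "{x, y}" L] card_mono[OF less.prems(1), of "{x, y}"] x y less.prems(1) by simp
    then obtain N where N: "partition_on (L - {x, y}) N" "\<forall>A\<in>N. card A = 2"
      using less.hyps[of "L - {x, y}"] less.prems by auto
    have "partition_on L (insert {x, y} N)"
      using N(1) x y by (subst partition_on_insert[where A = L]) (auto simp: disjnt_def partition_on_def)
    then show ?thesis using N(2) y(2) by (intro exI[of _ "insert {x, y} N"]) auto
  qed
qed

text \<open>
  A family \<open>T\<close> of disjoint blocks of allowed size extends to a diagram in the category.  The remaining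
  points become singletons, or, in the Brauer category, are paired up.
\<close>

lemma extend_to_diagram:
  assumes T: "disjoint T" "{} \<notin> T" "\<Union>T \<subseteq> points m n" "\<And>A. A \<in> T \<Longrightarrow> card A \<in> s"
    and s: "1 \<in> s \<or> s = {2} \<and> even (m + n)"
  shows "\<exists>\<beta>\<in>sized_cat s m n. T \<subseteq> \<beta> \<and> (\<forall>A\<in>\<beta> - T. card A = 1 \<or> s = {2})"
proof -
  let ?L = "points m n - \<Union>T"
  have "\<exists>N. partition_on ?L N \<and> (\<forall>A\<in>N. card A \<in> s \<and> (card A = 1 \<or> s = {2}))"
  proof (cases "1 \<in> s")
    case True
    have "partition_on ?L ((\<lambda>x. {x}) ` ?L)" by (rule partition_on_singletons)
    then show ?thesis using True by (intro exI[of _ "(\<lambda>x. {x}) ` ?L"]) auto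
  next
    case False
    with s have s2: "s = {2}" and ev: "even (m + n)" by auto
    have fin: "finite (\<Union>T)" using T(3) finite_subset finite_points by blast
    have "2 dvd card (\<Union>T)"
    proof (rule dvd_partition[OF fin])
      show "\<forall>A\<in>T. 2 dvd card A" using T(4) s2 by auto
      show "\<forall>A\<in>T. \<forall>B\<in>T. A \<noteq> B \<longrightarrow> A \<inter> B = {}" using T(1) by (simp add: disjoint_def)
    qed
    moreover have "card (points m n) = card (\<Union>T) + card ?L"
      using T(3) fin by (metis card_Diff_subset card_mono finite_points le_add_diff_inverse)
    ultimately have "even (card ?L)" using ev by (metis card_points even_add)
    then show ?thesis using pairing_exists[of ?L] s2 by auto
  qed
  then obtain N where N: "partition_on ?L N" "\<forall>A\<in>N. card A \<in> s \<and> (card A = 1 \<or> s = {2})"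
    by blast
  have UN: "\<Union>N = ?L" using partition_onD1[OF N(1)] by simp
  have "partition_on (points m n) (T \<union> N)"
  proof (rule partition_onI)
    show "\<Union>(T \<union> N) = points m n" using UN T(3) by auto
    show "{} \<notin> T \<union> N" using T(2) partition_onD3[OF N(1)] by simp
    have "disjoint (T \<union> N)"
      using T(1) partition_onD2[OF N(1)] UN by (intro disjoint_union) auto
    then show "disjnt A B" if "A \<in> T \<union> N" "B \<in> T \<union> N" "A \<noteq> B" for A B
      using that by (simp add: disjoint_def disjnt_def)
  qed
  then have "T \<union> N \<in> sized_cat s m n" using N(2) T(4) by (auto simp: sized_cat_def partition_cat_def)
  then show ?thesis using N(2) by (intro bexI[of _ "T \<union> N"]) auto
qed

lemma small_through_block:
  assumes \<alpha>: "\<alpha> \<in> sized_cat s m n" and s: "s \<subseteq> {1, 2}" and A: "A \<in> through \<alpha>"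
    and x: "Plain x \<in> A" and y: "Prime y \<in> A"
  shows "A = {Plain x, Prime y}"
proof -
  have fin: "finite A"
    using A block_subset[OF sized_cat_partition[OF \<alpha>], of A] finite_subset[OF _ finite_points]
    unfolding through_iff by blast
  have "card A \<le> 2" using A \<alpha> s by (auto simp: sized_cat_def through_iff)
  moreover have "{Plain x, Prime y} \<subseteq> A" using x y by simp
  ultimately show ?thesis using card_seteq[OF fin, of "{Plain x, Prime y}"] by simp
qed

text \<open>
  Replacing the lower half of each transversal \<open>A\<close> of \<open>\<alpha>\<close> by the single point \<open>f A\<close>, in a new lower
  row of \<open>c\<close> points, gives a diagram in the same category.  Unused lower points are joined to each
  other at most, and only in the Brauer category.
\<close>

lemma upper_factor:
  assumes \<alpha>: "\<alpha> \<in> sized_cat s a b" and s: "s \<in> {UNIV, {1, 2}, {2}}"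
    and f: "inj_on f (through \<alpha>)" "f ` through \<alpha> \<subseteq> {1..c}"
    and even: "s = {2} \<Longrightarrow> even (a + c)"
  shows "\<exists>\<gamma>\<in>sized_cat s a c.
    (\<forall>x y. (Plain x, Plain y) \<in> edges \<gamma> \<longleftrightarrow> (Plain x, Plain y) \<in> edges \<alpha>) \<and>
    (\<forall>x u. (Plain x, Prime u) \<in> edges \<gamma> \<longleftrightarrow> (\<exists>A\<in>through \<alpha>. Plain x \<in> A \<and> u = f A)) \<and>
    (\<forall>u v. (Prime u, Prime v) \<in> edges \<gamma> \<longrightarrow>
       u = v \<or> s = {2} \<and> u \<notin> f ` through \<alpha> \<and> v \<notin> f ` through \<alpha>)"
proof -
  note P = sized_cat_partition[OF \<alpha>]
  define U where "U = {A \<in> \<alpha>. \<exists>x. Plain x \<in> A}"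
  \<comment> \<open>\<open>g A\<close> is the block of the new diagram that has the upper points of \<open>A\<close>.\<close>
  define g where "g A = A \<inter> range Plain \<union> (if A \<in> through \<alpha> then {Prime (f A)} else {})" for A
  have gP: "Plain x \<in> g A \<longleftrightarrow> Plain x \<in> A" for x A by (auto simp: g_def)
  have gQ: "Prime u \<in> g A \<longleftrightarrow> A \<in> through \<alpha> \<and> u = f A" for u A by (auto simp: g_def)
  have gD: "DPrime u \<notin> g A" for u A by (auto simp: g_def)
  have eq: "A = B" if "A \<in> \<alpha>" "B \<in> \<alpha>" "z \<in> g A" "z \<in> g B" for A B z
  proof (cases z)
    case (Plain x)
    then have "Plain x \<in> A" "Plain x \<in> B" using that(3,4) by (simp_all add: gP)
    then show ?thesis using block_eq[OF P that(1,2)] by blast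
  next
    case (Prime u)
    then have "A \<in> through \<alpha>" "B \<in> through \<alpha>" "f A = f B" using that(3,4) by (simp_all add: gQ)
    then show ?thesis using inj_onD[OF f(1)] by blast
  next
    case (DPrime u)
    then show ?thesis using that(3) gD by simp
  qed
  have "\<exists>\<gamma>\<in>sized_cat s a c. g ` U \<subseteq> \<gamma> \<and> (\<forall>A\<in>\<gamma> - g ` U. card A = 1 \<or> s = {2})"
  proof (rule extend_to_diagram)
    show "disjoint (g ` U)" using eq unfolding disjoint_def U_def by blast
    show "{} \<notin> g ` U" using gP unfolding U_def by blast
    show "\<Union> (g ` U) \<subseteq> points a c"
    proof
      fix z assume "z \<in> \<Union> (g ` U)"
      then obtain A where A: "A \<in> \<alpha>" "z \<in> g A" by (auto simp: U_def)
      then show "z \<in> points a c"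
        using gP gQ gD f(2) block_subset[OF P A(1)] by (cases z) auto
    qed
    show "card B \<in> s" if B: "B \<in> g ` U" for B
    proof -
      obtain A x where A: "A \<in> \<alpha>" "Plain x \<in> A" "B = g A" using B by (auto simp: U_def)
      have cA: "card A \<in> s" using \<alpha> A(1) by (auto simp: sized_cat_def)
      show ?thesis
      proof (cases "A \<in> through \<alpha>")
        case False
        then have "Prime y \<notin> A" for y using A by (auto simp: through_iff)
        moreover have "DPrime y \<notin> A" for y using block_subset[OF P A(1)] by auto
        ultimately have "A \<subseteq> range Plain" by (metis point.exhaust rangeI subsetI)
        then have "g A = A" using False by (auto simp: g_def)
        then show ?thesis using A cA by simp
      next
        case True
        show ?thesis
        proof (cases "s = UNIV")
          case False
          obtain y where y: "Prime y \<in> A" using True by (auto simp: through_iff)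
          have "A = {Plain x, Prime y}"
            using small_through_block[OF \<alpha> _ True A(2) y] s False by auto
          then have "g A = {Plain x, Prime (f A)}" using True by (auto simp: g_def)
          moreover have "2 \<in> s" using s by auto
          ultimately show ?thesis using A(3) by (simp add: numeral_2_eq_2)
        qed simp
      qed
    qed
    show "1 \<in> s \<or> s = {2} \<and> even (a + c)" using s even by auto
  qed
  then obtain \<gamma> where \<gamma>: "\<gamma> \<in> sized_cat s a c" "g ` U \<subseteq> \<gamma>"
    and rest: "\<forall>A\<in>\<gamma> - g ` U. card A = 1 \<or> s = {2}" by (elim bexE conjE)
  note G = sized_cat_partition[OF \<gamma>(1)]
  have blk: "\<exists>A\<in>U. B = g A" if "B \<in> \<gamma>" "Plain x \<in> B" for B x
  proof -
    have "Plain x \<in> points a b" using block_subset[OF G that(1)] that(2) by auto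
    then have "(Plain x, Plain x) \<in> edges \<alpha>" by (rule edges_refl[OF P])
    then obtain A where A: "A \<in> \<alpha>" "Plain x \<in> A" unfolding edges_iff by blast
    then have "A \<in> U" by (auto simp: U_def)
    moreover have "B = g A" using block_eq[OF G that(1) _ that(2)] \<gamma>(2) \<open>A \<in> U\<close> A gP by blast
    ultimately show ?thesis by blast
  qed
  have mem: "A \<in> U" if "A \<in> through \<alpha>" for A using that by (auto simp: U_def through_iff)
  show ?thesis
  proof (intro bexI[OF _ \<gamma>(1)] conjI allI impI)
    show "(Plain x, Plain y) \<in> edges \<gamma> \<longleftrightarrow> (Plain x, Plain y) \<in> edges \<alpha>" for x y
    proof
      assume "(Plain x, Plain y) \<in> edges \<gamma>"
      then obtain B where B: "B \<in> \<gamma>" "Plain x \<in> B" "Plain y \<in> B" unfolding edges_iff by blast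
      then obtain A where "A \<in> U" "Plain x \<in> g A" "Plain y \<in> g A" using blk[OF B(1,2)] by blast
      then show "(Plain x, Plain y) \<in> edges \<alpha>" unfolding edges_iff U_def gP by blast
    next
      assume "(Plain x, Plain y) \<in> edges \<alpha>"
      then obtain A where "A \<in> U" "Plain x \<in> g A" "Plain y \<in> g A" unfolding edges_iff U_def gP by blast
      then show "(Plain x, Plain y) \<in> edges \<gamma>" using \<gamma>(2) unfolding edges_iff by blast
    qed
    show "(Plain x, Prime u) \<in> edges \<gamma> \<longleftrightarrow> (\<exists>A\<in>through \<alpha>. Plain x \<in> A \<and> u = f A)" for x u
    proof
      assume "(Plain x, Prime u) \<in> edges \<gamma>"
      then obtain B where B: "B \<in> \<gamma>" "Plain x \<in> B" "Prime u \<in> B" unfolding edges_iff by blast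
      then obtain A where "A \<in> U" "Plain x \<in> g A" "Prime u \<in> g A" using blk[OF B(1,2)] by blast
      then show "\<exists>A\<in>through \<alpha>. Plain x \<in> A \<and> u = f A" unfolding gP gQ by blast
    next
      assume "\<exists>A\<in>through \<alpha>. Plain x \<in> A \<and> u = f A"
      then obtain A where "A \<in> U" "Plain x \<in> g A" "Prime u \<in> g A" using mem unfolding gP gQ by blast
      then show "(Plain x, Prime u) \<in> edges \<gamma>" using \<gamma>(2) unfolding edges_iff by blast
    qed
    fix u v assume "(Prime u, Prime v) \<in> edges \<gamma>"
    then obtain B where B: "B \<in> \<gamma>" "Prime u \<in> B" "Prime v \<in> B" by (auto simp: edges_iff)
    show "u = v \<or> s = {2} \<and> u \<notin> f ` through \<alpha> \<and> v \<notin> f ` through \<alpha>"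
    proof (cases "B \<in> g ` U")
      case True
      then show ?thesis using B gQ by auto
    next
      case False
      have no: "w \<notin> f ` through \<alpha>" if w: "Prime w \<in> B" for w
      proof
        assume "w \<in> f ` through \<alpha>"
        then obtain A where A: "A \<in> through \<alpha>" "Prime w \<in> g A" using gQ by blast
        then have "g A \<in> \<gamma>" using mem \<gamma>(2) by blast
        then have "B = g A" using block_eq[OF G B(1) _ w A(2)] by blast
        then show False using False mem A(1) by blast
      qed
      have "card B = 1 \<or> s = {2}" using bspec[OF rest, of B] B(1) False by blast
      then show ?thesis
      proof
        assume "card B = 1"
        then show ?thesis using B by (auto simp: card_1_singleton_iff)
      qed (use no B in blast)
    qed
  qed
qed

text \<open>
  The reflected form of \<open>upper_factor\<close>.
\<close>

lemma lower_factor: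
  assumes \<alpha>: "\<alpha> \<in> sized_cat s a b" and s: "s \<in> {UNIV, {1, 2}, {2}}"
    and f: "inj_on f (through \<alpha>)" "f ` through \<alpha> \<subseteq> {1..c}"
    and even: "s = {2} \<Longrightarrow> even (b + c)"
  shows "\<exists>\<delta>\<in>sized_cat s c b.
    (\<forall>x y. (Prime x, Prime y) \<in> edges \<delta> \<longleftrightarrow> (Prime x, Prime y) \<in> edges \<alpha>) \<and>
    (\<forall>x u. (Plain u, Prime x) \<in> edges \<delta> \<longleftrightarrow> (\<exists>A\<in>through \<alpha>. Prime x \<in> A \<and> u = f A)) \<and>
    (\<forall>u v. (Plain u, Plain v) \<in> edges \<delta> \<longrightarrow>
       u = v \<or> s = {2} \<and> u \<notin> f ` through \<alpha> \<and> v \<notin> f ` through \<alpha>)"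
proof -
  let ?f = "\<lambda>B. f (swap ` B)"
  have 1: "swap ` swap ` A = A" for A by (simp add: image_image)
  have 2: "?f ` through (flip \<alpha>) = f ` through \<alpha>"
    by (simp add: through_flip image_image 1)
  have 3: "inj_on ?f (through (flip \<alpha>))"
    using f(1) by (auto simp: through_flip inj_on_def 1)
  from upper_factor[OF flip_in_sized_cat[OF \<alpha>] s 3 _ even] f(2)
  obtain \<gamma> where \<gamma>: "\<gamma> \<in> sized_cat s b c"
    and A: "\<And>x y. (Plain x, Plain y) \<in> edges \<gamma> \<longleftrightarrow> (Plain x, Plain y) \<in> edges (flip \<alpha>)"
    and B: "\<And>x u. (Plain x, Prime u) \<in> edges \<gamma> \<longleftrightarrow> (\<exists>A\<in>through (flip \<alpha>). Plain x \<in> A \<and> u = ?f A)"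
    and C: "\<And>u v. (Prime u, Prime v) \<in> edges \<gamma> \<Longrightarrow>
       u = v \<or> s = {2} \<and> u \<notin> f ` through \<alpha> \<and> v \<notin> f ` through \<alpha>"
    unfolding 2 by blast
  show ?thesis
  proof (intro bexI[OF _ flip_in_sized_cat[OF \<gamma>]] conjI allI impI)
    show "(Prime x, Prime y) \<in> edges (flip \<gamma>) \<longleftrightarrow> (Prime x, Prime y) \<in> edges \<alpha>" for x y
      using A by (simp add: edges_flip)
    have "(\<exists>A\<in>through (flip \<alpha>). Plain x \<in> A \<and> u = ?f A) \<longleftrightarrow> (\<exists>A\<in>through \<alpha>. Prime x \<in> A \<and> u = f A)" for x u
      by (simp add: through_flip 1)
    then show "(Plain u, Prime x) \<in> edges (flip \<gamma>) \<longleftrightarrow> (\<exists>A\<in>through \<alpha>. Prime x \<in> A \<and> u = f A)" for x u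
      using B edges_sym by (metis edges_flip swap.simps(1,2))
    show "u = v \<or> s = {2} \<and> u \<notin> f ` through \<alpha> \<and> v \<notin> f ` through \<alpha>"
      if "(Plain u, Plain v) \<in> edges (flip \<gamma>)" for u v
      using C that by (simp add: edges_flip)
  qed
qed

section \<open>Computing threefold products by colourings\<close>

text \<open>
  A symmetric property of pairs of points need only be checked on three of the four kinds of edges.
\<close>

lemma edges_wlog:
  assumes \<alpha>: "\<alpha> \<in> partition_cat m n" and e: "(x, y) \<in> edges \<alpha>"
    and sym: "\<And>x y. Q x y \<Longrightarrow> Q y x"
    and uu: "\<And>x y. (Plain x, Plain y) \<in> edges \<alpha> \<Longrightarrow> Q (Plain x) (Plain y)"
    and ul: "\<And>x y. (Plain x, Prime y) \<in> edges \<alpha> \<Longrightarrow> Q (Plain x) (Prime y)"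
    and ll: "\<And>x y. (Prime x, Prime y) \<in> edges \<alpha> \<Longrightarrow> Q (Prime x) (Prime y)"
  shows "Q x y"
proof -
  note pts = edges_points[OF \<alpha> e] and e' = edges_sym[OF e]
  show ?thesis
  proof (cases x)
    case x: (Plain u)
    show ?thesis
    proof (cases y)
      case (Plain v) then show ?thesis using uu[of u v] e x by simp
    next
      case (Prime v) then show ?thesis using ul[of u v] e x by simp
    qed (use pts in simp)
  next
    case x: (Prime u)
    show ?thesis
    proof (cases y)
      case (Plain v) then show ?thesis using sym[OF ul[of v u]] e' x by simp
    next
      case (Prime v) then show ?thesis using ll[of u v] e x by simp
    qed (use pts in simp)
  qed (use pts in simp)
qed

text \<open>
  \<open>colour f g\<close> colours the upper points of a diagram by \<open>f\<close> and the lower points by \<open>g\<close>.  A pair of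
  colourings is compatible with a diagram if it is constant on every block.
\<close>

fun colour :: "(nat \<Rightarrow> 'c) \<Rightarrow> (nat \<Rightarrow> 'c) \<Rightarrow> point \<Rightarrow> 'c" where
  "colour f g (Plain x) = f x"
| "colour f g (Prime x) = g x"
| "colour f g (DPrime x) = g x"

definition compatible :: "(nat \<Rightarrow> 'c) \<Rightarrow> (nat \<Rightarrow> 'c) \<Rightarrow> diagram \<Rightarrow> bool" where
  "compatible f g \<alpha> \<longleftrightarrow> (\<forall>x y. (x, y) \<in> edges \<alpha> \<longrightarrow> colour f g x = colour f g y)"

lemma compatibleI:
  assumes "\<alpha> \<in> partition_cat m n"
    and "\<And>x y. (Plain x, Plain y) \<in> edges \<alpha> \<Longrightarrow> f x = f y"
    and "\<And>x y. (Plain x, Prime y) \<in> edges \<alpha> \<Longrightarrow> f x = g y"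
    and "\<And>x y. (Prime x, Prime y) \<in> edges \<alpha> \<Longrightarrow> g x = g y"
  shows "compatible f g \<alpha>"
  unfolding compatible_def
proof clarify
  fix x y assume e: "(x, y) \<in> edges \<alpha>"
  show "colour f g x = colour f g y"
    by (rule edges_wlog[OF assms(1) e]) (simp_all add: assms(2-4))
qed

text \<open>
  If all three factors respect a colouring of the four layers, then so does the product: points of
  different colour are not connected.
\<close>

lemma prod3_colour:
  assumes \<alpha>: "\<alpha> \<in> partition_cat a b" and \<beta>: "\<beta> \<in> partition_cat b c" and \<gamma>: "\<gamma> \<in> partition_cat c d"
    and r: "compatible f0 f1 \<alpha>" "compatible f1 f2 \<beta>" "compatible f2 f3 \<gamma>"
    and e: "(x, y) \<in> edges (diagram_prod a d (diagram_prod a c \<alpha> \<beta>) \<gamma>)"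
  shows "colour f0 f3 x = colour f0 f3 y"
proof -
  define c where "c = (\<lambda>(i::nat, x). if i = 0 then f0 x else if i = 1 then f1 x else if i = 2 then f2 x else f3 x)"
  have c: "c (lab 0 1 z) = colour f0 f1 z" "c (lab 1 2 z) = colour f1 f2 z"
    "c (lab 2 3 z) = colour f2 f3 z" "c (lab 0 3 z) = colour f0 f3 z" for z
    by (cases z; simp add: c_def)+
  have step: "c p = c q" if "(p, q) \<in> graph3 \<alpha> \<beta> \<gamma>" for p q
    using that r c by (auto simp: graph3_def layer_def compatible_def simp del: One_nat_def)
  have "c p = c q" if "(p, q) \<in> (graph3 \<alpha> \<beta> \<gamma>)\<^sup>*" for p q
    using that by (induction rule: rtrancl_induct) (auto dest: step)
  from this[of "lab 0 3 x" "lab 0 3 y"] show ?thesis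
    using e by (simp add: prod3_left[OF \<alpha> \<beta> \<gamma>] c)
qed

lemma prod3_edges:
  assumes \<alpha>: "\<alpha> \<in> partition_cat a b" and \<beta>: "\<beta> \<in> partition_cat b c" and \<gamma>: "\<gamma> \<in> partition_cat c d"
  shows "(Plain x, Plain y) \<in> edges \<alpha> \<Longrightarrow>
           (Plain x, Plain y) \<in> edges (diagram_prod a d (diagram_prod a c \<alpha> \<beta>) \<gamma>)"
    and "(Prime x, Prime y) \<in> edges \<gamma> \<Longrightarrow>
           (Prime x, Prime y) \<in> edges (diagram_prod a d (diagram_prod a c \<alpha> \<beta>) \<gamma>)"
    and "\<lbrakk>(Plain x, Prime u) \<in> edges \<alpha>; (Plain u, Prime v) \<in> edges \<beta>; (Plain v, Prime y) \<in> edges \<gamma>\<rbrakk> \<Longrightarrow>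
           (Plain x, Prime y) \<in> edges (diagram_prod a d (diagram_prod a c \<alpha> \<beta>) \<gamma>)"
proof -
  have L: "(lab 0 1 z, lab 0 1 z') \<in> graph3 \<alpha> \<beta> \<gamma>" if "(z, z') \<in> edges \<alpha>" for z z'
    using that by (force simp: graph3_def layer_def)
  have M: "(lab 1 2 z, lab 1 2 z') \<in> graph3 \<alpha> \<beta> \<gamma>" if "(z, z') \<in> edges \<beta>" for z z'
    using that by (force simp: graph3_def layer_def)
  have R: "(lab 2 3 z, lab 2 3 z') \<in> graph3 \<alpha> \<beta> \<gamma>" if "(z, z') \<in> edges \<gamma>" for z z'
    using that by (force simp: graph3_def layer_def)
  note p3 = prod3_left[OF \<alpha> \<beta> \<gamma>]
  show "(Plain x, Plain y) \<in> edges (diagram_prod a d (diagram_prod a c \<alpha> \<beta>) \<gamma>)"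
    if "(Plain x, Plain y) \<in> edges \<alpha>"
    using L[OF that] edges_points[OF \<alpha> that] by (auto simp: p3)
  show "(Prime x, Prime y) \<in> edges (diagram_prod a d (diagram_prod a c \<alpha> \<beta>) \<gamma>)"
    if "(Prime x, Prime y) \<in> edges \<gamma>"
    using R[OF that] edges_points[OF \<gamma> that] by (auto simp: p3)
  show "(Plain x, Prime y) \<in> edges (diagram_prod a d (diagram_prod a c \<alpha> \<beta>) \<gamma>)"
    if e: "(Plain x, Prime u) \<in> edges \<alpha>" "(Plain u, Prime v) \<in> edges \<beta>" "(Plain v, Prime y) \<in> edges \<gamma>"
  proof -
    have "((0, x), (1, u)) \<in> graph3 \<alpha> \<beta> \<gamma>" "((1, u), (2, v)) \<in> graph3 \<alpha> \<beta> \<gamma>" "((2, v), (3, y)) \<in> graph3 \<alpha> \<beta> \<gamma>"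
      using L[OF e(1)] M[OF e(2)] R[OF e(3)] by simp_all
    then have "((0, x), (3, y)) \<in> (graph3 \<alpha> \<beta> \<gamma>)\<^sup>*" by (meson r_into_rtrancl rtrancl_trans)
    then show ?thesis using edges_points[OF \<alpha> e(1)] edges_points[OF \<gamma> e(3)] by (simp add: p3)
  qed
qed

text \<open>
  A criterion for \<open>\<alpha>\<beta>\<gamma> = \<tau>\<close>.  The connections in \<open>\<tau>\<close> are realized by paths in the factors, and the
  colouring \<open>h\<close> of the outer layers by the blocks of \<open>\<tau>\<close> extends to the inner layers, so that there are
  no further connections.
\<close>

lemma prod3_eqI:
  assumes \<alpha>: "\<alpha> \<in> partition_cat a b" and \<beta>: "\<beta> \<in> partition_cat b c" and \<gamma>: "\<gamma> \<in> partition_cat c d"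
    and \<tau>: "\<tau> \<in> partition_cat a d"
    and up: "\<And>x y. (Plain x, Plain y) \<in> edges \<tau> \<Longrightarrow> (Plain x, Plain y) \<in> edges \<alpha>"
    and low: "\<And>x y. (Prime x, Prime y) \<in> edges \<tau> \<Longrightarrow> (Prime x, Prime y) \<in> edges \<gamma>"
    and mid: "\<And>x y. (Plain x, Prime y) \<in> edges \<tau> \<Longrightarrow> \<exists>u v. (Plain x, Prime u) \<in> edges \<alpha> \<and>
                (Plain u, Prime v) \<in> edges \<beta> \<and> (Plain v, Prime y) \<in> edges \<gamma>"
    and h: "\<And>x. h x = edges \<tau> `` {x}"
    and r: "compatible (\<lambda>x. h (Plain x)) f \<alpha>" "compatible f g \<beta>" "compatible g (\<lambda>x. h (Prime x)) \<gamma>"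
  shows "diagram_prod a d (diagram_prod a c \<alpha> \<beta>) \<gamma> = \<tau>"
proof (rule diagram_eqI[OF prod_in_cat \<tau>])
  let ?P = "diagram_prod a d (diagram_prod a c \<alpha> \<beta>) \<gamma>"
  note e3 = prod3_edges[OF \<alpha> \<beta> \<gamma>]
  show "edges ?P = edges \<tau>"
  proof (intro equalityI subrelI)
    fix x y assume e: "(x, y) \<in> edges ?P"
    note pts = edges_points[OF prod_in_cat e]
    have "h x = h y"
      using prod3_colour[OF \<alpha> \<beta> \<gamma> r e] pts by (cases x; cases y) simp_all
    moreover have "y \<in> h y" using edges_refl[OF \<tau> pts(2)] by (simp add: h)
    ultimately have "y \<in> edges \<tau> `` {x}" by (simp only: h)
    then show "(x, y) \<in> edges \<tau>" by blast
  next
    fix x y assume e: "(x, y) \<in> edges \<tau>"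
    have mid': "(Plain u, Prime v) \<in> edges ?P" if "(Plain u, Prime v) \<in> edges \<tau>" for u v
      using mid[OF that] e3(3) by blast
    show "(x, y) \<in> edges ?P"
      by (rule edges_wlog[OF \<tau> e, where Q = "\<lambda>x y. (x, y) \<in> edges ?P"])
         (auto intro: edges_sym mid' e3(1)[OF up] e3(2)[OF low])
  qed
qed

text \<open>
  In each of the categories, \<open>\<alpha>\<close> factors through any \<open>\<tau>\<close> of at least the same rank.  The transversals
  of \<open>\<alpha>\<close> are routed along distinct transversals of \<open>\<tau>\<close>, chosen by \<open>\<phi>\<close>.  The parity condition makes it
  possible to pair up the remaining points in the Brauer category.
\<close>

lemma factor_through_diagram:
  assumes s: "s \<in> {UNIV, {1, 2}, {2}}"
    and \<alpha>: "\<alpha> \<in> sized_cat s a b" and \<tau>: "\<tau> \<in> sized_cat s c d" and r: "rank \<alpha> \<le> rank \<tau>"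
    and even: "s = {2} \<Longrightarrow> even (a + c) \<and> even (b + d)"
  shows "\<exists>\<gamma>\<in>sized_cat s a c. \<exists>\<delta>\<in>sized_cat s d b. diagram_prod a b (diagram_prod a d \<gamma> \<tau>) \<delta> = \<alpha>"
proof -
  note A = sized_cat_partition[OF \<alpha>] and T = sized_cat_partition[OF \<tau>]
  obtain \<phi> where \<phi>: "\<phi> ` through \<alpha> \<subseteq> through \<tau>" "inj_on \<phi> (through \<alpha>)"
    using card_le_inj[OF finite_through[OF A] finite_through[OF T]] r by (auto simp: rank_through)
  have "\<forall>Y\<in>through \<tau>. \<exists>x. Plain x \<in> Y" "\<forall>Y\<in>through \<tau>. \<exists>x. Prime x \<in> Y" by (auto simp: through_iff)
  then obtain p q where p: "\<And>Y. Y \<in> through \<tau> \<Longrightarrow> Plain (p Y) \<in> Y"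
    and q: "\<And>Y. Y \<in> through \<tau> \<Longrightarrow> Prime (q Y) \<in> Y" by metis
  have \<phi>': "\<phi> X \<in> through \<tau>" "\<phi> X \<in> \<tau>" if "X \<in> through \<alpha>" for X
  proof -
    show "\<phi> X \<in> through \<tau>" using that \<phi>(1) by blast
    then show "\<phi> X \<in> \<tau>" by (simp add: through_iff)
  qed
  have uniq: "X = Y" if "X \<in> through \<alpha>" "Y \<in> through \<alpha>" "z \<in> \<phi> X" "z \<in> \<phi> Y" for X Y z
    using that \<phi>' block_eq[OF T] inj_onD[OF \<phi>(2)] by metis
  have pinj: "inj_on (\<lambda>X. p (\<phi> X)) (through \<alpha>)"
    by (rule inj_onI) (metis uniq p \<phi>'(1))
  have qinj: "inj_on (\<lambda>X. q (\<phi> X)) (through \<alpha>)"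
    by (rule inj_onI) (metis uniq q \<phi>'(1))
  have pr: "(\<lambda>X. p (\<phi> X)) ` through \<alpha> \<subseteq> {1..c}"
  proof (rule image_subsetI)
    fix X assume "X \<in> through \<alpha>"
    then have "Plain (p (\<phi> X)) \<in> points c d" using p \<phi>' block_subset[OF T] by blast
    then show "p (\<phi> X) \<in> {1..c}" by simp
  qed
  have qr: "(\<lambda>X. q (\<phi> X)) ` through \<alpha> \<subseteq> {1..d}"
  proof (rule image_subsetI)
    fix X assume "X \<in> through \<alpha>"
    then have "Prime (q (\<phi> X)) \<in> points c d" using q \<phi>' block_subset[OF T] by blast
    then show "q (\<phi> X) \<in> {1..d}" by simp
  qed
  obtain \<gamma> where \<gamma>: "\<gamma> \<in> sized_cat s a c"
    and g1: "\<And>x y. (Plain x, Plain y) \<in> edges \<gamma> \<longleftrightarrow> (Plain x, Plain y) \<in> edges \<alpha>"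
    and g2: "\<And>x u. (Plain x, Prime u) \<in> edges \<gamma> \<longleftrightarrow> (\<exists>A\<in>through \<alpha>. Plain x \<in> A \<and> u = p (\<phi> A))"
    and g3: "\<And>u v. (Prime u, Prime v) \<in> edges \<gamma> \<Longrightarrow>
       u = v \<or> s = {2} \<and> u \<notin> (\<lambda>X. p (\<phi> X)) ` through \<alpha> \<and> v \<notin> (\<lambda>X. p (\<phi> X)) ` through \<alpha>"
    using upper_factor[OF \<alpha> s pinj pr] even by blast
  obtain \<delta> where \<delta>: "\<delta> \<in> sized_cat s d b"
    and d1: "\<And>x y. (Prime x, Prime y) \<in> edges \<delta> \<longleftrightarrow> (Prime x, Prime y) \<in> edges \<alpha>"
    and d2: "\<And>x u. (Plain u, Prime x) \<in> edges \<delta> \<longleftrightarrow> (\<exists>A\<in>through \<alpha>. Prime x \<in> A \<and> u = q (\<phi> A))"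
    and d3: "\<And>u v. (Plain u, Plain v) \<in> edges \<delta> \<Longrightarrow>
       u = v \<or> s = {2} \<and> u \<notin> (\<lambda>X. q (\<phi> X)) ` through \<alpha> \<and> v \<notin> (\<lambda>X. q (\<phi> X)) ` through \<alpha>"
    using lower_factor[OF \<alpha> s qinj qr] even by blast
  note G = sized_cat_partition[OF \<gamma>] and D = sized_cat_partition[OF \<delta>]
  \<comment> \<open>The inner points are coloured by the transversal of \<open>\<alpha>\<close> that is routed through their block of \<open>\<tau>\<close>, or by the empty set if there is none.\<close>
  define k where "k z = \<Union>{X \<in> through \<alpha>. z \<in> \<phi> X}" for z
  have k: "k z = X" if "X \<in> through \<alpha>" "z \<in> \<phi> X" for X z
    unfolding k_def using that uniq by blast
  have k0: "k z = {}" if "\<And>X. X \<in> through \<alpha> \<Longrightarrow> z \<notin> \<phi> X" for z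
    unfolding k_def using that by blast
  have block: "edges \<alpha> `` {x} = X" if "X \<in> through \<alpha>" "x \<in> X" for X x
    using block_of_edge[OF A _ that(2)] that(1) by (auto simp: through_iff)
  have cls: "edges \<alpha> `` {x} = edges \<alpha> `` {y}" if "(x, y) \<in> edges \<alpha>" for x y
    using that edges_trans[OF A] edges_sym by blast
  have pair: "\<phi> X = {Plain (p (\<phi> X)), Prime (q (\<phi> X))}" if "X \<in> through \<alpha>" "s = {2}" for X
    using small_through_block[OF \<tau> _ \<phi>'(1) p[OF \<phi>'(1)] q[OF \<phi>'(1)]] that by auto
  have "diagram_prod a b (diagram_prod a d \<gamma> \<tau>) \<delta> = \<alpha>"
  proof (rule prod3_eqI[OF G T D A, where h = "\<lambda>x. edges \<alpha> `` {x}"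
        and f = "\<lambda>u. k (Plain u)" and g = "\<lambda>v. k (Prime v)"])
    show "\<exists>u v. (Plain x, Prime u) \<in> edges \<gamma> \<and> (Plain u, Prime v) \<in> edges \<tau> \<and> (Plain v, Prime y) \<in> edges \<delta>"
      if "(Plain x, Prime y) \<in> edges \<alpha>" for x y
    proof -
      from that obtain X where X: "X \<in> through \<alpha>" "Plain x \<in> X" "Prime y \<in> X" by (auto simp: through_edge)
      have "(Plain (p (\<phi> X)), Prime (q (\<phi> X))) \<in> edges \<tau>"
        unfolding edges_iff using p[OF \<phi>'(1)[OF X(1)]] q[OF \<phi>'(1)[OF X(1)]] \<phi>'(2)[OF X(1)] by blast
      moreover have "(Plain x, Prime (p (\<phi> X))) \<in> edges \<gamma>" "(Plain (q (\<phi> X)), Prime y) \<in> edges \<delta>"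
        unfolding g2 d2 using X by blast+
      ultimately show ?thesis by blast
    qed
    show "compatible (\<lambda>x. edges \<alpha> `` {Plain x}) (\<lambda>u. k (Plain u)) \<gamma>"
    proof (rule compatibleI[OF G])
      show "edges \<alpha> `` {Plain x} = k (Plain u)" if "(Plain x, Prime u) \<in> edges \<gamma>" for x u
      proof -
        from that g2 obtain X where X: "X \<in> through \<alpha>" "Plain x \<in> X" "u = p (\<phi> X)" by blast
        then show ?thesis using block[OF X(1,2)] k[OF X(1)] p[OF \<phi>'(1)[OF X(1)]] by simp
      qed
      show "k (Plain u) = k (Plain v)" if "(Prime u, Prime v) \<in> edges \<gamma>" for u v
      proof -
        have "k (Plain w) = {}" if "s = {2}" "w \<notin> (\<lambda>X. p (\<phi> X)) ` through \<alpha>" for w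
          using that pair by (intro k0) blast
        then show ?thesis using g3[OF that] by auto
      qed
    qed (use g1 cls in blast)
    show "compatible (\<lambda>u. k (Plain u)) (\<lambda>v. k (Prime v)) \<tau>"
    proof -
      have "k z = k z'" if "(z, z') \<in> edges \<tau>" for z z'
      proof -
        have "z \<in> \<phi> X \<longleftrightarrow> z' \<in> \<phi> X" if "X \<in> through \<alpha>" for X
          using \<open>(z, z') \<in> edges \<tau>\<close> block_of_edge[OF T \<phi>'(2)[OF that]] edges_sym by blast
        then show ?thesis unfolding k_def by blast
      qed
      then show ?thesis by (intro compatibleI[OF T]) blast+
    qed
    show "compatible (\<lambda>v. k (Prime v)) (\<lambda>x. edges \<alpha> `` {Prime x}) \<delta>"
    proof (rule compatibleI[OF D])
      show "k (Prime u) = edges \<alpha> `` {Prime x}" if "(Plain u, Prime x) \<in> edges \<delta>" for x u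
      proof -
        from that d2 obtain X where X: "X \<in> through \<alpha>" "Prime x \<in> X" "u = q (\<phi> X)" by blast
        then show ?thesis using block[OF X(1,2)] k[OF X(1)] q[OF \<phi>'(1)[OF X(1)]] by simp
      qed
      show "k (Prime u) = k (Prime v)" if "(Plain u, Plain v) \<in> edges \<delta>" for u v
      proof -
        have "k (Prime w) = {}" if "s = {2}" "w \<notin> (\<lambda>X. q (\<phi> X)) ` through \<alpha>" for w
          using that pair by (intro k0) blast
        then show ?thesis using d3[OF that] by auto
      qed
    qed (use d1 cls in blast)
  qed (use g1 d1 in simp_all)
  then show ?thesis using \<gamma> \<delta> by blast
qed

section \<open>Elements of higher rank in a sandwich\<close>

lemma sized_cat_2_even:
  assumes "\<sigma> \<in> sized_cat {2} m n" shows "even (m + n)"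
proof -
  have p: "partition_on (points m n) \<sigma>" using assms by (simp add: sized_cat_def partition_cat_def)
  have "2 dvd card (\<Union>\<sigma>)"
    by (rule dvd_partition)
       (use assms partition_onD1[OF p, symmetric] partition_onD2[OF p] in \<open>auto simp: sized_cat_def disjoint_def\<close>)
  then show ?thesis by (simp add: partition_onD1[OF p, symmetric] card_points)
qed

text \<open>
  Two-point blocks joining \<open>t z\<close> to \<open>u z\<close>, for \<open>z \<in> Z\<close>, extend to a diagram.  The last clause says that
  two colourings are compatible with it as soon as they agree along the matching and, in the
  Brauer category, have one common value on all unmatched points.
\<close>

lemma matching_diagram:
  fixes t u :: "'z \<Rightarrow> nat"
  assumes s: "s \<in> {UNIV, {1, 2}, {2}}"
    and t: "inj_on t Z" "t ` Z \<subseteq> {1..m}" and u: "inj_on u Z" "u ` Z \<subseteq> {1..n}"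
    and even: "s = {2} \<Longrightarrow> even (m + n)"
  shows "\<exists>\<beta>\<in>sized_cat s m n. card Z \<le> rank \<beta> \<and>
    (\<forall>z\<in>Z. (Plain (t z), Prime (u z)) \<in> edges \<beta>) \<and>
    (\<forall>f g :: nat \<Rightarrow> 'c. \<forall>c.
       (\<forall>z\<in>Z. f (t z) = g (u z)) \<longrightarrow>
       (s = {2} \<longrightarrow> (\<forall>x\<in>{1..m} - t ` Z. f x = c) \<and> (\<forall>y\<in>{1..n} - u ` Z. g y = c)) \<longrightarrow>
       compatible f g \<beta>)"
proof -
  define E where "E z = {Plain (t z), Prime (u z)}" for z
  have EP: "Plain x \<in> E z \<longleftrightarrow> x = t z" and EQ: "Prime x \<in> E z \<longleftrightarrow> x = u z" for x z
    by (auto simp: E_def)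
  have "\<exists>\<beta>\<in>sized_cat s m n. E ` Z \<subseteq> \<beta> \<and> (\<forall>A\<in>\<beta> - E ` Z. card A = 1 \<or> s = {2})"
  proof (rule extend_to_diagram)
    have "E z \<inter> E z' = {}" if "z \<in> Z" "z' \<in> Z" "z \<noteq> z'" for z z'
      using that inj_onD[OF t(1)] inj_onD[OF u(1)] unfolding E_def by blast
    then show "disjoint (E ` Z)" unfolding disjoint_def by blast
    show "{} \<notin> E ` Z" by (auto simp: E_def)
    show "\<Union> (E ` Z) \<subseteq> points m n" using t(2) u(2) by (auto simp: E_def)
    have "2 \<in> s" using s by auto
    then show "card A \<in> s" if "A \<in> E ` Z" for A
      using that by (auto simp: E_def numeral_2_eq_2)
    show "1 \<in> s \<or> s = {2} \<and> even (m + n)" using s even by auto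
  qed
  then obtain \<beta> where \<beta>: "\<beta> \<in> sized_cat s m n" "E ` Z \<subseteq> \<beta>"
    and rest: "\<forall>A\<in>\<beta> - E ` Z. card A = 1 \<or> s = {2}" by (elim bexE conjE)
  note B = sized_cat_partition[OF \<beta>(1)]
  have E_edge: "(Plain (t z), y) \<in> edges \<beta> \<longleftrightarrow> y \<in> E z" if "z \<in> Z" for z y
    by (rule block_of_edge[OF B]) (use that \<beta>(2) EP in auto)
  have edge: "(Plain (t z), Prime (u z)) \<in> edges \<beta>" if "z \<in> Z" for z
    by (simp add: E_edge[OF that] EQ)
  have "card Z \<le> rank \<beta>"
  proof (rule rank_ge[OF B edge])
    show "z = z'" if "z \<in> Z" "z' \<in> Z" "(Plain (t z), Plain (t z')) \<in> edges \<beta>" for z z'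
      using that E_edge[OF that(1)] EP inj_onD[OF t(1)] by metis
  qed
  moreover have "compatible f g \<beta>"
    if m: "\<forall>z\<in>Z. f (t z) = g (u z)"
      and c: "s = {2} \<longrightarrow> (\<forall>x\<in>{1..m} - t ` Z. f x = c) \<and> (\<forall>y\<in>{1..n} - u ` Z. g y = c)"
    for f g :: "nat \<Rightarrow> 'c" and c
  proof -
    have "colour f g x = colour f g y" if A: "A \<in> \<beta>" "x \<in> A" "y \<in> A" for A x y
    proof (cases "A \<in> E ` Z")
      case True
      then show ?thesis using A m by (auto simp: E_def)
    next
      case False
      then have "card A = 1 \<or> s = {2}" using bspec[OF rest, of A] A(1) by blast
      then show ?thesis
      proof
        assume "card A = 1"
        then show ?thesis using A by (auto simp: card_1_singleton_iff)
      next
        assume s2: "s = {2}"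
        have "colour f g w = c" if w: "w \<in> A" for w
        proof -
          have pw: "w \<in> points m n" using block_subset[OF B A(1)] w by blast
          have nw: "w \<notin> E z" if "z \<in> Z" for z
            using block_eq[OF B A(1) _ w] \<beta>(2) that False by blast
          show ?thesis
          proof (cases w)
            case (Plain x)
            then have "x \<notin> t ` Z" using nw EP by blast
            then show ?thesis using Plain pw c s2 by simp
          next
            case (Prime x)
            then have "x \<notin> u ` Z" using nw EQ by blast
            then show ?thesis using Prime pw c s2 by simp
          qed (use pw in simp)
        qed
        then show ?thesis using A by simp
      qed
    qed
    then show ?thesis unfolding compatible_def edges_iff by blast
  qed
  ultimately show ?thesis using \<beta>(1) edge by (intro bexI[of _ \<beta>]) auto
qed

text \<open>
  There is \<open>\<beta>\<close> of rank greater than that of \<open>\<sigma>\<close> such that \<open>\<sigma>\<beta>\<sigma>\<close> has rank at least that of \<open>\<sigma>\<close>.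
  Membership of \<open>\<sigma>\<beta>\<sigma>\<close> in the category is recorded since it does not follow from any closure property
  proved here: in the first case below \<open>\<sigma>\<beta>\<sigma> = \<sigma>\<close>, and in the second the category consists of all
  partitions.
\<close>

lemma higher_rank_preserving:
  assumes s: "s \<in> {UNIV, {1, 2}, {2}}" and \<sigma>: "\<sigma> \<in> sized_cat s n m"
    and r: "rank \<sigma> < n" and nm: "n \<le> m"
  shows "\<exists>\<beta>\<in>sized_cat s m n. rank \<sigma> < rank \<beta> \<and>
    diagram_prod n m (diagram_prod n n \<sigma> \<beta>) \<sigma> \<in> sized_cat s n m \<and>
    rank \<sigma> \<le> rank (diagram_prod n m (diagram_prod n n \<sigma> \<beta>) \<sigma>)"
proof -
  note P = sized_cat_partition[OF \<sigma>]
  have even: "even (m + n)" if "s = {2}" using sized_cat_2_even \<sigma> that by auto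
  have "\<forall>Y\<in>through \<sigma>. \<exists>x. Plain x \<in> Y" "\<forall>Y\<in>through \<sigma>. \<exists>x. Prime x \<in> Y" by (auto simp: through_iff)
  then obtain p q where p: "\<And>Y. Y \<in> through \<sigma> \<Longrightarrow> Plain (p Y) \<in> Y"
    and q: "\<And>Y. Y \<in> through \<sigma> \<Longrightarrow> Prime (q Y) \<in> Y" by metis
  have blk: "Y \<in> \<sigma>" if "Y \<in> through \<sigma>" for Y using that by (simp add: through_iff)
  have pr: "p Y \<in> {1..n}" and qr: "q Y \<in> {1..m}" if "Y \<in> through \<sigma>" for Y
    using block_subset[OF P blk[OF that]] p[OF that] q[OF that] by auto
  have pinj: "p Y = p Y' \<Longrightarrow> Y = Y'" and qinj: "q Y = q Y' \<Longrightarrow> Y = Y'"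
    if "Y \<in> through \<sigma>" "Y' \<in> through \<sigma>" for Y Y'
    using block_eq[OF P blk blk] p q that by metis+
  define B where "B z = edges \<sigma> `` {z}" for z
  have B: "B z = Y" if "Y \<in> through \<sigma>" "z \<in> Y" for Y z
    using block_of_edge[OF P blk that(2)] that(1) by (auto simp: B_def)
  have Beq: "B x = B y" if "(x, y) \<in> edges \<sigma>" for x y
    using that edges_trans[OF P] edges_sym unfolding B_def by blast
  have Bthrough: "B (Plain x) \<in> through \<sigma>" "B (Prime y) \<in> through \<sigma>" if xy: "(Plain x, Prime y) \<in> edges \<sigma>" for x y
  proof -
    obtain Y where "Y \<in> through \<sigma>" "Plain x \<in> Y" "Prime y \<in> Y" using xy unfolding through_edge by blast
    then show "B (Plain x) \<in> through \<sigma>" "B (Prime y) \<in> through \<sigma>" using B by simp_all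
  qed
  have mem: "z \<in> B z" if "z \<in> points n m" for z using edges_refl[OF P that] by (simp add: B_def)
  have small: "z = Plain (p Y) \<or> z = Prime (q Y)" if "Y \<in> through \<sigma>" "z \<in> Y" "s \<noteq> UNIV" for z Y
    using small_through_block[OF \<sigma> _ that(1) p[OF that(1)] q[OF that(1)]] s that by auto
  have exists_unused: "\<exists>x\<in>{1..k}. x \<notin> f ` through \<sigma>" if "n \<le> k" for k f
  proof (rule ccontr)
    assume "\<not> ?thesis"
    then have "{1..k} \<subseteq> f ` through \<sigma>" by blast
    then have "card {1..k} \<le> card (f ` through \<sigma>)"
      by (rule card_mono[rotated]) (simp add: finite_through[OF P])
    also have "\<dots> \<le> rank \<sigma>" unfolding rank_through by (rule card_image_le[OF finite_through[OF P]])
    finally show False using r that by simp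
  qed
  \<comment> \<open>The index \<open>None\<close> stands for the extra edge of \<open>\<beta>\<close>, from \<open>b\<close> to \<open>a\<close>.\<close>
  let ?Z = "insert None (Some ` through \<sigma>)"
  have cardZ: "card ?Z = Suc (rank \<sigma>)"
    using finite_through[OF P] by (subst card_insert_disjoint) (auto simp: rank_through card_image)
  show ?thesis
  proof (cases "\<exists>a\<in>{1..n} - p ` through \<sigma>. \<exists>b\<in>{1..m} - q ` through \<sigma>.
      B (Plain a) \<notin> through \<sigma> \<or> B (Prime b) \<notin> through \<sigma>")
    case True
    then obtain a b where a: "a \<in> {1..n}" "a \<notin> p ` through \<sigma>" and b: "b \<in> {1..m}" "b \<notin> q ` through \<sigma>"
      and ab: "B (Plain a) \<notin> through \<sigma> \<or> B (Prime b) \<notin> through \<sigma>" by blast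
    \<comment> \<open>The colour of nontransversal blocks next to \<open>\<beta>\<close>, chosen so that the edge from \<open>b\<close> to \<open>a\<close> is respected.\<close>
    define c where "c = (if B (Prime b) \<in> through \<sigma> then B (Prime b)
      else if B (Plain a) \<in> through \<sigma> then B (Plain a) else {})"
    define F where "F z = (if B z \<in> through \<sigma> then B z else c)" for z
    have 1: "inj_on (case_option b q) ?Z" "case_option b q ` ?Z \<subseteq> {1..m}"
      using b qinj qr by (auto simp: inj_on_def)
    have 2: "inj_on (case_option a p) ?Z" "case_option a p ` ?Z \<subseteq> {1..n}"
      using a pinj pr by (auto simp: inj_on_def)
    obtain \<beta> where \<beta>: "\<beta> \<in> sized_cat s m n" "card ?Z \<le> rank \<beta>"
      and edge: "\<forall>z\<in>?Z. (Plain (case_option b q z), Prime (case_option a p z)) \<in> edges \<beta>"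
      and comp: "\<And>f g :: nat \<Rightarrow> point set. \<And>c.
       (\<forall>z\<in>?Z. f (case_option b q z) = g (case_option a p z)) \<Longrightarrow>
       (s = {2} \<longrightarrow> (\<forall>x\<in>{1..m} - case_option b q ` ?Z. f x = c) \<and>
          (\<forall>y\<in>{1..n} - case_option a p ` ?Z. g y = c)) \<Longrightarrow> compatible f g \<beta>"
      using matching_diagram[OF s 1 2 even, where 'c = "point set"] by blast
    have Fc: "compatible (\<lambda>x. F (Prime x)) (\<lambda>x. F (Plain x)) \<beta>"
    proof (rule comp[where c = c])
      have "F (Prime (q Y)) = F (Plain (p Y))" if "Y \<in> through \<sigma>" for Y
        using B[OF that p[OF that]] B[OF that q[OF that]] by (simp add: F_def)
      moreover have "F (Prime b) = F (Plain a)" using ab by (simp add: F_def c_def)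
      ultimately show "\<forall>z\<in>?Z. F (Prime (case_option b q z)) = F (Plain (case_option a p z))" by auto
      have Fz: "F z = c" if "s = {2}" "z \<in> points n m" "\<And>Y. Y \<in> through \<sigma> \<Longrightarrow> z \<noteq> Plain (p Y) \<and> z \<noteq> Prime (q Y)" for z
      proof -
        have "s \<noteq> UNIV" using that(1) by (metis UNIV_I singletonD zero_neq_numeral)
        then show ?thesis using small[of "B z" z] mem[OF that(2)] that(3) by (auto simp: F_def)
      qed
      have "F (Prime x) = c" if "s = {2}" "x \<in> {1..m} - case_option b q ` ?Z" for x
        using that by (intro Fz) (auto simp: image_image)
      moreover have "F (Plain y) = c" if "s = {2}" "y \<in> {1..n} - case_option a p ` ?Z" for y
        using that by (intro Fz) (auto simp: image_image)
      ultimately show "s = {2} \<longrightarrow> (\<forall>x\<in>{1..m} - case_option b q ` ?Z. F (Prime x) = c) \<and>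
          (\<forall>y\<in>{1..n} - case_option a p ` ?Z. F (Plain y) = c)"
        by blast
    qed
    have "diagram_prod n m (diagram_prod n n \<sigma> \<beta>) \<sigma> = \<sigma>"
    proof (rule prod3_eqI[OF P sized_cat_partition[OF \<beta>(1)] P P _ _ _ B_def _ Fc _])
      show "\<exists>u v. (Plain x, Prime u) \<in> edges \<sigma> \<and> (Plain u, Prime v) \<in> edges \<beta> \<and> (Plain v, Prime y) \<in> edges \<sigma>"
        if xy: "(Plain x, Prime y) \<in> edges \<sigma>" for x y
      proof -
        obtain Y where Y: "Y \<in> through \<sigma>" "Plain x \<in> Y" "Prime y \<in> Y" using xy unfolding through_edge by blast
        have "(Plain x, Prime (q Y)) \<in> edges \<sigma>" "(Plain (p Y), Prime y) \<in> edges \<sigma>"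
          using Y(2,3) p[OF Y(1)] q[OF Y(1)] blk[OF Y(1)] unfolding edges_iff by blast+
        moreover have "(Plain (q Y), Prime (p Y)) \<in> edges \<beta>"
          using bspec[OF edge, of "Some Y"] Y(1) by simp
        ultimately show ?thesis by blast
      qed
      show "compatible (\<lambda>x. B (Plain x)) (\<lambda>x. F (Prime x)) \<sigma>"
        by (rule compatibleI[OF P]) (use Beq Bthrough in \<open>auto simp: F_def\<close>)
      show "compatible (\<lambda>x. F (Plain x)) (\<lambda>x. B (Prime x)) \<sigma>"
        by (rule compatibleI[OF P]) (use Beq Bthrough in \<open>auto simp: F_def\<close>)
    qed
    then show ?thesis using \<beta> \<sigma> cardZ by (intro bexI[OF _ \<beta>(1)]) auto
  next
    case False
    obtain a b where a: "a \<in> {1..n}" "a \<notin> p ` through \<sigma>" and b: "b \<in> {1..m}" "b \<notin> q ` through \<sigma>"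
      using exists_unused[of n p] exists_unused[of m q] nm by blast
    define X Y where "X = B (Plain a)" and "Y = B (Prime b)"
    have X: "X \<in> through \<sigma>" "Plain a \<in> X" and Y: "Y \<in> through \<sigma>" "Prime b \<in> Y"
      using False a b mem by (auto simp: X_def Y_def)
    \<comment> \<open>A transversal of at most two points has no upper point besides the chosen one.\<close>
    have sU: "s = UNIV" using small[OF X] a(2) X(1) by auto
    \<comment> \<open>Now \<open>Y\<close> is matched with \<open>X\<close>, so the extra edge from \<open>b \<in> Y\<close> to \<open>a \<in> X\<close> is parallel to a matching edge.\<close>
    define \<psi> where "\<psi> = Transposition.transpose X Y"
    have \<psi>\<psi>: "\<psi> (\<psi> A) = A" for A by (simp add: \<psi>_def)
    have \<psi>: "\<psi> A \<in> through \<sigma>" if "A \<in> through \<sigma>" for A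
      using that X Y by (auto simp: \<psi>_def Transposition.transpose_def)
    have \<psi>inj: "\<psi> A = \<psi> A' \<Longrightarrow> A = A'" for A A' by (metis \<psi>\<psi>)
    have 1: "inj_on (case_option b q) ?Z" "case_option b q ` ?Z \<subseteq> {1..m}"
      using b qinj qr by (auto simp: inj_on_def)
    have 2: "inj_on (case_option a (p \<circ> \<psi>)) ?Z" "case_option a (p \<circ> \<psi>) ` ?Z \<subseteq> {1..n}"
      using a pinj pr \<psi> \<psi>inj by (auto simp: inj_on_def)
    obtain \<beta> where \<beta>: "\<beta> \<in> sized_cat s m n" "card ?Z \<le> rank \<beta>"
      and edge: "\<forall>z\<in>?Z. (Plain (case_option b q z), Prime (case_option a (p \<circ> \<psi>) z)) \<in> edges \<beta>"
      and comp: "\<And>f g :: nat \<Rightarrow> point set. \<And>c.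
       (\<forall>z\<in>?Z. f (case_option b q z) = g (case_option a (p \<circ> \<psi>) z)) \<Longrightarrow>
       (s = {2} \<longrightarrow> (\<forall>x\<in>{1..m} - case_option b q ` ?Z. f x = c) \<and>
          (\<forall>y\<in>{1..n} - case_option a (p \<circ> \<psi>) ` ?Z. g y = c)) \<Longrightarrow> compatible f g \<beta>"
      using matching_diagram[OF s 1 2 even, where 'c = "point set"] by blast
    note Q = sized_cat_partition[OF \<beta>(1)]
    have Fc: "compatible (\<lambda>x. B (Prime x)) (\<lambda>x. \<psi> (B (Plain x))) \<beta>"
    proof (rule comp[where c = "{}"])
      have "s \<noteq> {2}" unfolding sU by (metis UNIV_I singletonD zero_neq_numeral)
      then show "s = {2} \<longrightarrow> (\<forall>x\<in>{1..m} - case_option b q ` ?Z. B (Prime x) = {}) \<and>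
          (\<forall>y\<in>{1..n} - case_option a (p \<circ> \<psi>) ` ?Z. \<psi> (B (Plain y)) = {})" by blast
      have "B (Prime (q A)) = \<psi> (B (Plain (p (\<psi> A))))" if "A \<in> through \<sigma>" for A
        using B[OF \<psi>[OF that] p[OF \<psi>[OF that]]] B[OF that q[OF that]] by (simp add: \<psi>\<psi>)
      moreover have "B (Prime b) = \<psi> (B (Plain a))"
        by (simp add: \<psi>_def flip: X_def Y_def)
      ultimately show "\<forall>z\<in>?Z. B (Prime (case_option b q z)) = \<psi> (B (Plain (case_option a (p \<circ> \<psi>) z)))" by auto
    qed
    let ?P = "diagram_prod n m (diagram_prod n n \<sigma> \<beta>) \<sigma>"
    have "card (through \<sigma>) \<le> rank ?P"
    proof (rule rank_ge[OF prod_in_cat, where u = p and v = "\<lambda>A. q (\<psi> A)"])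
      show "(Plain (p A), Prime (q (\<psi> A))) \<in> edges ?P" if A: "A \<in> through \<sigma>" for A
      proof (rule prod3_edges(3)[OF P Q P])
        show "(Plain (p A), Prime (q A)) \<in> edges \<sigma>"
          using p[OF A] q[OF A] blk[OF A] unfolding edges_iff by blast
        show "(Plain (p (\<psi> A)), Prime (q (\<psi> A))) \<in> edges \<sigma>"
          using p[OF \<psi>[OF A]] q[OF \<psi>[OF A]] blk[OF \<psi>[OF A]] unfolding edges_iff by blast
        show "(Plain (q A), Prime (p (\<psi> A))) \<in> edges \<beta>"
          using bspec[OF edge, of "Some A"] A by simp
      qed
      show "A = A'" if A: "A \<in> through \<sigma>" "A' \<in> through \<sigma>" and e: "(Plain (p A), Plain (p A')) \<in> edges ?P" for A A'
      proof -
        have "compatible (\<lambda>x. B (Plain x)) (\<lambda>x. B (Prime x)) \<sigma>"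
          by (rule compatibleI[OF P]) (simp_all add: Beq)
        moreover have "compatible (\<lambda>x. \<psi> (B (Plain x))) (\<lambda>x. \<psi> (B (Prime x))) \<sigma>"
          by (rule compatibleI[OF P]) (simp_all add: Beq)
        ultimately have "B (Plain (p A)) = B (Plain (p A'))"
          using prod3_colour[OF P Q P _ Fc _ e] by simp
        then show ?thesis using B[OF A(1) p[OF A(1)]] B[OF A(2) p[OF A(2)]] by simp
      qed
    qed
    moreover have "?P \<in> sized_cat s n m" using prod_in_cat by (simp add: sized_cat_def sU)
    ultimately show ?thesis using \<beta> cardZ by (intro bexI[OF _ \<beta>(1)]) (auto simp: rank_through)
  qed
qed

section \<open>The sandwich semigroup\<close>

text \<open>
  The sandwich \<open>S\<close> on the hom-set \<open>K\<close>.  Products of elements of \<open>K\<close> are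
  in general only treated as elements of the partition category.
\<close>

locale sandwich_category =
  fixes s :: "nat set" and m n :: nat and \<sigma> :: diagram
  assumes sizes: "s \<in> {UNIV, {1, 2}, {2}}" and \<sigma>: "\<sigma> \<in> sized_cat s n m"
begin

abbreviation S :: "diagram monoid" where
  "S \<equiv> sandwich (sized_cat s) m n \<sigma>"

abbreviation K :: "diagram set" where
  "K \<equiv> sized_cat s m n"

lemma \<sigma>_partition: "\<sigma> \<in> partition_cat n m"
  by (rule sized_cat_partition[OF \<sigma>])

lemma carrier_S: "carrier S = K"
  by (simp add: sandwich_def)

lemma mult_left: "\<alpha> \<otimes>\<^bsub>S\<^esub> \<beta> = diagram_prod m n (diagram_prod m m \<alpha> \<sigma>) \<beta>"
  by (simp add: sandwich_def)

lemma mult_right: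
  assumes "\<alpha> \<in> partition_cat m n" "\<beta> \<in> partition_cat m n"
  shows "\<alpha> \<otimes>\<^bsub>S\<^esub> \<beta> = diagram_prod m n \<alpha> (diagram_prod n n \<sigma> \<beta>)"
  unfolding mult_left by (rule diagram_prod_assoc[OF assms(1) \<sigma>_partition assms(2)])

lemma mult_partition: "\<alpha> \<otimes>\<^bsub>S\<^esub> \<beta> \<in> partition_cat m n"
  by (simp add: mult_left)

lemma mult_assoc:
  assumes "\<alpha> \<in> partition_cat m n" "\<beta> \<in> partition_cat m n" "\<gamma> \<in> partition_cat m n"
  shows "(\<alpha> \<otimes>\<^bsub>S\<^esub> \<beta>) \<otimes>\<^bsub>S\<^esub> \<gamma> = \<alpha> \<otimes>\<^bsub>S\<^esub> (\<beta> \<otimes>\<^bsub>S\<^esub> \<gamma>)"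
proof -
  have "(\<alpha> \<otimes>\<^bsub>S\<^esub> \<beta>) \<otimes>\<^bsub>S\<^esub> \<gamma> =
      diagram_prod m n (diagram_prod m n (diagram_prod m m \<alpha> \<sigma>) \<beta>) (diagram_prod n n \<sigma> \<gamma>)"
    by (subst mult_right[OF mult_partition assms(3)]) (simp add: mult_left)
  also have "\<dots> = diagram_prod m n (diagram_prod m m \<alpha> \<sigma>) (diagram_prod m n \<beta> (diagram_prod n n \<sigma> \<gamma>))"
    by (rule diagram_prod_assoc[OF prod_in_cat assms(2) prod_in_cat])
  also have "\<dots> = \<alpha> \<otimes>\<^bsub>S\<^esub> (\<beta> \<otimes>\<^bsub>S\<^esub> \<gamma>)"
    by (simp add: mult_left[of \<alpha>] mult_right[OF assms(2,3)])
  finally show ?thesis .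
qed

lemma rank_mult_le:
  assumes "\<alpha> \<in> partition_cat m n" "\<beta> \<in> partition_cat m n"
  shows "rank (\<alpha> \<otimes>\<^bsub>S\<^esub> \<beta>) \<le> rank \<sigma>"
  unfolding mult_left
  using rank_prod_left[OF prod_in_cat assms(2), of m \<alpha> \<sigma>] rank_prod_right[OF assms(1) \<sigma>_partition]
  by (rule order_trans)

lemma ideal_cases:
  assumes "\<alpha> \<in> two_sided_ideal S \<beta>" "\<beta> \<in> K"
  obtains "\<alpha> = \<beta>"
    | \<gamma> \<delta> where "\<gamma> \<in> partition_cat m n" "\<delta> \<in> partition_cat m n" "\<alpha> = \<gamma> \<otimes>\<^bsub>S\<^esub> \<delta>"
  using assms(1) unfolding two_sided_ideal_def carrier_S
  using mult_partition sized_cat_partition[of _ s m n] assms(2) by blast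

lemma self_in_ideal: "\<alpha> \<in> two_sided_ideal S \<alpha>"
  by (simp add: two_sided_ideal_def)

lemma high_rank_in_ideal:
  assumes "\<alpha> \<in> two_sided_ideal S \<beta>" "\<beta> \<in> K" "rank \<sigma> < rank \<alpha>"
  shows "\<alpha> = \<beta>"
  using assms(1,2) by (rule ideal_cases) (use rank_mult_le assms(3) in fastforce)+

lemma J_class: "\<alpha> \<in> K \<Longrightarrow> J_rel S `` {\<alpha>} = {\<beta> \<in> K. two_sided_ideal S \<beta> = two_sided_ideal S \<alpha>}"
  by (auto simp: J_rel_def carrier_S)

lemma J_classes_iff: "C \<in> J_classes S \<longleftrightarrow> (\<exists>\<alpha>\<in>K. C = J_rel S `` {\<alpha>})"
  by (auto simp: J_classes_def quotient_def carrier_S)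

lemma J_class_high_rank:
  assumes "\<alpha> \<in> K" "rank \<sigma> < rank \<alpha>"
  shows "J_rel S `` {\<alpha>} = {\<alpha>}"
  using assms high_rank_in_ideal[OF _ _ assms(2)] self_in_ideal by (auto simp: J_class)

text \<open>
  Elements of low rank are strictly below an element of high rank.
\<close>

lemma below_higher_rank:
  assumes "rank \<sigma> < n" "n \<le> m" "\<alpha> \<in> K" "rank \<alpha> \<le> rank \<sigma>"
  shows "\<exists>\<beta>\<in>K. rank \<sigma> < rank \<beta> \<and> \<alpha> \<in> two_sided_ideal S \<beta>"
proof -
  let ?\<tau> = "\<lambda>\<beta>. diagram_prod n m (diagram_prod n n \<sigma> \<beta>) \<sigma>"
  obtain \<beta> where \<beta>: "\<beta> \<in> K" "rank \<sigma> < rank \<beta>" "?\<tau> \<beta> \<in> sized_cat s n m" "rank \<sigma> \<le> rank (?\<tau> \<beta>)"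
    using higher_rank_preserving[OF sizes \<sigma> assms(1,2)] by blast
  have "even (m + n)" if "s = {2}" using sized_cat_2_even \<sigma> that by auto
  then obtain \<gamma> \<delta> where \<gamma>: "\<gamma> \<in> K" and \<delta>: "\<delta> \<in> K"
    and eq: "diagram_prod m n (diagram_prod m m \<gamma> (?\<tau> \<beta>)) \<delta> = \<alpha>"
    using factor_through_diagram[OF sizes assms(3) \<beta>(3)] assms(4) \<beta>(4) by fastforce
  note G = sized_cat_partition[OF \<gamma>] and B = sized_cat_partition[OF \<beta>(1)]
  have "diagram_prod m m \<gamma> (?\<tau> \<beta>) = diagram_prod m m (diagram_prod m n \<gamma> (diagram_prod n n \<sigma> \<beta>)) \<sigma>"
    by (rule diagram_prod_assoc[OF G prod_in_cat \<sigma>_partition, symmetric])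
  then have "\<alpha> = \<gamma> \<otimes>\<^bsub>S\<^esub> \<beta> \<otimes>\<^bsub>S\<^esub> \<delta>"
    by (simp add: eq[symmetric] mult_left[of _ \<delta>] mult_right[OF G B])
  then have "\<alpha> \<in> two_sided_ideal S \<beta>"
    using \<gamma> \<delta> by (auto simp: two_sided_ideal_def carrier_S)
  then show ?thesis using \<beta> by blast
qed

lemma maximal_J_classes:
  assumes "rank \<sigma> < n" "n \<le> m"
  shows "{C. maximal_J_class S C} = {{\<alpha>} | \<alpha>. \<alpha> \<in> K \<and> rank \<alpha> > rank \<sigma>}"
proof (intro equalityI subsetI)
  fix C assume "C \<in> {C. maximal_J_class S C}"
  then have C: "C \<in> J_classes S" and max: "\<And>D. D \<in> J_classes S \<Longrightarrow> J_le S C D \<Longrightarrow> D = C"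
    by (auto simp: maximal_J_class_def)
  obtain \<alpha> where \<alpha>: "\<alpha> \<in> K" "C = J_rel S `` {\<alpha>}" using C unfolding J_classes_iff by blast
  have \<alpha>C: "\<alpha> \<in> C" using \<alpha> by (simp add: J_class)
  have r: "rank \<sigma> < rank \<alpha>"
  proof (rule ccontr)
    assume "\<not> rank \<sigma> < rank \<alpha>"
    then obtain \<beta> where \<beta>: "\<beta> \<in> K" "rank \<sigma> < rank \<beta>" "\<alpha> \<in> two_sided_ideal S \<beta>"
      using below_higher_rank[OF assms \<alpha>(1)] by auto
    note cls = J_class_high_rank[OF \<beta>(1,2)]
    have "{\<beta>} \<in> J_classes S" unfolding J_classes_iff using \<beta>(1) cls by blast
    moreover have "J_le S C {\<beta>}" using \<alpha>C \<beta>(3) by (auto simp: J_le_def)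
    ultimately have "C = {\<beta>}" using max by blast
    then show False using \<alpha>C \<beta>(2) \<open>\<not> rank \<sigma> < rank \<alpha>\<close> by simp
  qed
  then show "C \<in> {{\<alpha>} | \<alpha>. \<alpha> \<in> K \<and> rank \<alpha> > rank \<sigma>}"
    using \<alpha> J_class_high_rank by auto
next
  fix C assume "C \<in> {{\<alpha>} | \<alpha>. \<alpha> \<in> K \<and> rank \<alpha> > rank \<sigma>}"
  then obtain \<alpha> where \<alpha>: "\<alpha> \<in> K" "rank \<sigma> < rank \<alpha>" "C = {\<alpha>}" by blast
  note cls = J_class_high_rank[OF \<alpha>(1,2)]
  have "C \<in> J_classes S" unfolding J_classes_iff using \<alpha> cls by blast
  moreover have "D = C" if D: "D \<in> J_classes S" "J_le S C D" for D
  proof -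
    obtain \<delta> where \<delta>: "\<delta> \<in> K" "D = J_rel S `` {\<delta>}" using D(1) unfolding J_classes_iff by blast
    obtain \<beta> where \<beta>: "\<beta> \<in> D" "\<alpha> \<in> two_sided_ideal S \<beta>" using D(2) \<alpha>(3) by (auto simp: J_le_def)
    have "\<beta> \<in> K" using \<beta>(1) \<delta> by (simp add: J_class)
    then have "\<alpha> = \<beta>" using high_rank_in_ideal \<beta>(2) \<alpha>(2) by blast
    then have "two_sided_ideal S \<alpha> = two_sided_ideal S \<delta>" using \<beta>(1) \<delta> by (simp add: J_class)
    then have "D = J_rel S `` {\<alpha>}" using \<delta> \<alpha>(1) by (simp add: J_class)
    then show ?thesis using cls \<alpha>(3) by simp
  qed
  ultimately show "C \<in> {C. maximal_J_class S C}" by (auto simp: maximal_J_class_def)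
qed

end

section \<open>The maximum class for a sandwich element of full rank\<close>

text \<open>
  \<open>act \<alpha> p\<close> multiplies \<open>\<alpha>\<close> on the right by a permutation and \<open>pre \<alpha>\<close> is \<open>\<sigma>\<alpha>\<close>.  The set \<open>D\<close> consists of
  the \<open>\<alpha>\<close> for which \<open>\<sigma>\<alpha>\<close> is a permutation; it is shown to be the set of regular elements of rank \<open>n\<close>.
\<close>

locale full_rank_sandwich = sandwich_category +
  assumes full: "rank \<sigma> = n"
begin

abbreviation perm :: "(nat \<Rightarrow> nat) \<Rightarrow> diagram" where
  "perm \<equiv> perm_diagram n"

abbreviation act :: "diagram \<Rightarrow> (nat \<Rightarrow> nat) \<Rightarrow> diagram" where
  "act \<alpha> p \<equiv> diagram_prod m n \<alpha> (perm_diagram n p)"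

abbreviation pre :: "diagram \<Rightarrow> diagram" where
  "pre \<alpha> \<equiv> diagram_prod n n \<sigma> \<alpha>"

definition D :: "diagram set" where
  "D = {\<alpha> \<in> K. \<exists>p. p permutes {1..n} \<and> pre \<alpha> = perm p}"

lemma act_K: "\<alpha> \<in> K \<Longrightarrow> p permutes {1..n} \<Longrightarrow> act \<alpha> p \<in> K"
  by (rule prod_perm_in_sized_cat)

lemma act_act:
  assumes "\<alpha> \<in> partition_cat m n" "p permutes {1..n}" "q permutes {1..n}"
  shows "act (act \<alpha> p) q = act \<alpha> (p \<circ> q)"
  using diagram_prod_assoc[OF assms(1) perm_diagram_in_partition_cat perm_diagram_in_partition_cat]
    assms(2,3) by (simp add: prod_perm_perm)

lemma act_id: "\<alpha> \<in> partition_cat m n \<Longrightarrow> act \<alpha> id = \<alpha>"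
  by (rule prod_perm_id)

lemma pre_act:
  assumes "\<alpha> \<in> partition_cat m n" "p permutes {1..n}" "q permutes {1..n}" "pre \<alpha> = perm p"
  shows "pre (act \<alpha> q) = perm (p \<circ> q)"
  using diagram_prod_assoc[OF \<sigma>_partition assms(1) perm_diagram_in_partition_cat[OF assms(3)]]
    assms(2-4) by (simp add: prod_perm_perm)

lemma mult_act:
  assumes "\<alpha> \<in> partition_cat m n" "\<beta> \<in> partition_cat m n" "pre \<beta> = perm p"
  shows "\<alpha> \<otimes>\<^bsub>S\<^esub> \<beta> = act \<alpha> p"
  using mult_right[OF assms(1,2)] assms(3) by simp

lemma perm_of_rank:
  assumes "n \<le> rank (pre \<alpha>)"
  obtains p where "p permutes {1..n}" "pre \<alpha> = perm p"
proof -
  have "rank (pre \<alpha>) = n" using assms rank_le_upper[OF prod_in_cat] by (rule antisym[rotated])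
  then show ?thesis using full_rank_square[OF prod_in_cat] that by blast
qed

lemma D_I:
  assumes "\<alpha> \<in> K" "n \<le> rank (pre \<alpha>)" shows "\<alpha> \<in> D"
  using perm_of_rank[OF assms(2)] assms(1) unfolding D_def by blast

text \<open>
  Some \<open>\<rho> \<in> K\<close> satisfies \<open>\<sigma>\<rho> = id\<close>, and is thus a right identity of the sandwich.
\<close>

lemma right_identity: "\<exists>\<rho>\<in>K. pre \<rho> = perm id"
proof -
  have "perm id \<in> sized_cat s n n"
    by (rule perm_diagram_in_sized_cat[OF permutes_id]) (use sizes in auto)
  moreover have "even (n + m)" if "s = {2}" using sized_cat_2_even \<sigma> that by simp
  moreover have "rank (perm id) = rank \<sigma>" using rank_perm_diagram[OF permutes_id] full by simp
  ultimately obtain \<gamma> \<delta> where \<gamma>: "\<gamma> \<in> sized_cat s n n" and \<delta>: "\<delta> \<in> K"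
    and eq: "diagram_prod n n (diagram_prod n m \<gamma> \<sigma>) \<delta> = perm id"
    using factor_through_diagram[OF sizes _ \<sigma>, of "perm id" n n] by auto
  note D = sized_cat_partition[OF \<delta>]
  have "perm id = diagram_prod n n \<gamma> (pre \<delta>)"
    using diagram_prod_assoc[OF sized_cat_partition[OF \<gamma>] \<sigma>_partition D] eq by simp
  then have "rank (perm id) \<le> rank (pre \<delta>)"
    using rank_prod_right[OF sized_cat_partition[OF \<gamma>] prod_in_cat] by simp
  then obtain q where q: "q permutes {1..n}" "pre \<delta> = perm q"
    using perm_of_rank rank_perm_diagram[OF permutes_id] by auto
  have "pre (act \<delta> (inv_into UNIV q)) = perm id"
    using pre_act[OF D q(1) permutes_inv[OF q(1)] q(2)] permutes_inv_o(1)[OF q(1)] by simp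
  then show ?thesis using act_K[OF \<delta> permutes_inv[OF q(1)]] by blast
qed

lemma D_class_eq: "D_class (sized_cat s) m n \<sigma> n = D"
proof (intro equalityI subsetI)
  fix \<alpha> assume "\<alpha> \<in> D_class (sized_cat s) m n \<sigma> n"
  then obtain \<xi> where \<alpha>: "\<alpha> \<in> K" "rank \<alpha> = n" and \<xi>: "\<alpha> = \<alpha> \<otimes>\<^bsub>S\<^esub> \<xi> \<otimes>\<^bsub>S\<^esub> \<alpha>"
    by (auto simp: D_class_def regular_elements_def carrier_S)
  have "rank \<alpha> = rank (diagram_prod m n (\<alpha> \<otimes>\<^bsub>S\<^esub> \<xi>) (pre \<alpha>))"
    using mult_right[OF mult_partition sized_cat_partition[OF \<alpha>(1)]] \<xi> by metis
  also have "\<dots> \<le> rank (pre \<alpha>)" by (rule rank_prod_right[OF mult_partition prod_in_cat])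
  finally show "\<alpha> \<in> D" using \<alpha> by (intro D_I) simp_all
next
  fix \<alpha> assume "\<alpha> \<in> D"
  then obtain p where \<alpha>: "\<alpha> \<in> K" and p: "p permutes {1..n}" "pre \<alpha> = perm p" by (auto simp: D_def)
  note A = sized_cat_partition[OF \<alpha>] and ip = permutes_inv[OF p(1)]
  obtain \<rho> where \<rho>: "\<rho> \<in> K" "pre \<rho> = perm id" using right_identity by blast
  let ?\<xi> = "act \<rho> (inv_into UNIV p)"
  have \<xi>: "?\<xi> \<in> K" by (rule act_K[OF \<rho>(1) ip])
  have "pre ?\<xi> = perm (inv_into UNIV p)"
    using pre_act[OF sized_cat_partition[OF \<rho>(1)] permutes_id ip \<rho>(2)] by simp
  then have "\<alpha> \<otimes>\<^bsub>S\<^esub> ?\<xi> = act \<alpha> (inv_into UNIV p)"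
    by (rule mult_act[OF A sized_cat_partition[OF \<xi>]])
  then have "\<alpha> \<otimes>\<^bsub>S\<^esub> ?\<xi> \<otimes>\<^bsub>S\<^esub> \<alpha> = act (act \<alpha> (inv_into UNIV p)) p"
    using mult_act[OF mult_partition A p(2), of \<alpha> ?\<xi>] by simp
  also have "\<dots> = \<alpha>" using act_act[OF A ip p(1)] permutes_inv_o(2)[OF p(1)] act_id[OF A] by simp
  finally have "\<alpha> \<in> regular_elements S"
    using \<alpha> \<xi> by (auto simp: regular_elements_def carrier_S intro!: bexI[of _ ?\<xi>])
  moreover have "rank \<alpha> = n"
    using rank_prod_right[OF \<sigma>_partition A] rank_perm_diagram[OF p(1)] p(2) rank_le_lower[OF A] by simp
  ultimately show "\<alpha> \<in> D_class (sized_cat s) m n \<sigma> n" by (simp add: D_class_def)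
qed

text \<open>
  Right multiplication by an element of \<open>D\<close> permutes \<open>K\<close>.  Hence all elements of \<open>D\<close> generate the same
  ideal, which contains all of \<open>K\<close>.
\<close>

lemma ideal_D:
  assumes "\<beta> \<in> D"
  shows "two_sided_ideal S \<beta> = K \<union> {\<xi> \<otimes>\<^bsub>S\<^esub> \<eta> | \<xi> \<eta>. \<xi> \<in> K \<and> \<eta> \<in> K}"
proof -
  obtain p where \<beta>: "\<beta> \<in> K" and p: "p permutes {1..n}" "pre \<beta> = perm p" using assms by (auto simp: D_def)
  note B = sized_cat_partition[OF \<beta>] and ip = permutes_inv[OF p(1)]
  have mult: "\<xi> \<otimes>\<^bsub>S\<^esub> \<beta> = act \<xi> p" if "\<xi> \<in> K" for \<xi>
    using mult_act[OF sized_cat_partition[OF that] B p(2)] .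
  have onto: "\<exists>\<zeta>\<in>K. \<zeta> \<otimes>\<^bsub>S\<^esub> \<beta> = \<xi>" if \<xi>: "\<xi> \<in> K" for \<xi>
  proof (intro bexI)
    show "act \<xi> (inv_into UNIV p) \<in> K" by (rule act_K[OF \<xi> ip])
    then show "act \<xi> (inv_into UNIV p) \<otimes>\<^bsub>S\<^esub> \<beta> = \<xi>"
      using mult act_act[OF _ ip p(1)] act_id permutes_inv_o(2)[OF p(1)] sized_cat_partition[OF \<xi>] by simp
  qed
  have into: "\<xi> \<otimes>\<^bsub>S\<^esub> \<beta> \<in> K" if "\<xi> \<in> K" for \<xi> using act_K[OF that p(1)] mult[OF that] by simp
  show ?thesis
  proof (intro equalityI subsetI)
    fix \<alpha> assume "\<alpha> \<in> two_sided_ideal S \<beta>"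
    then show "\<alpha> \<in> K \<union> {\<xi> \<otimes>\<^bsub>S\<^esub> \<eta> | \<xi> \<eta>. \<xi> \<in> K \<and> \<eta> \<in> K}"
      unfolding two_sided_ideal_def carrier_S using into \<beta> by blast
  next
    fix \<alpha> assume "\<alpha> \<in> K \<union> {\<xi> \<otimes>\<^bsub>S\<^esub> \<eta> | \<xi> \<eta>. \<xi> \<in> K \<and> \<eta> \<in> K}"
    then consider "\<alpha> \<in> K" | \<xi> \<eta> where "\<xi> \<in> K" "\<eta> \<in> K" "\<alpha> = \<xi> \<otimes>\<^bsub>S\<^esub> \<eta>" by blast
    then show "\<alpha> \<in> two_sided_ideal S \<beta>"
    proof cases
      case 1
      then obtain \<zeta> where "\<zeta> \<in> K" "\<alpha> = \<zeta> \<otimes>\<^bsub>S\<^esub> \<beta>" using onto by metis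
      then show ?thesis unfolding two_sided_ideal_def carrier_S by blast
    next
      case 2
      then obtain \<zeta> where "\<zeta> \<in> K" "\<xi> = \<zeta> \<otimes>\<^bsub>S\<^esub> \<beta>" using onto by metis
      then show ?thesis using 2 unfolding two_sided_ideal_def carrier_S by blast
    qed
  qed
qed

lemma D_if_right_identity_in_ideal:
  assumes \<beta>: "\<beta> \<in> K" and \<rho>: "\<rho> \<in> K" "pre \<rho> = perm id" and mem: "\<rho> \<in> two_sided_ideal S \<beta>"
  shows "\<beta> \<in> D"
proof -
  note B = sized_cat_partition[OF \<beta>]
  have left: "rank (pre (\<xi> \<otimes>\<^bsub>S\<^esub> \<beta>)) \<le> rank (pre \<beta>)" if "\<xi> \<in> partition_cat m n" for \<xi>
  proof -
    have "pre (\<xi> \<otimes>\<^bsub>S\<^esub> \<beta>) = diagram_prod n n (pre \<xi>) (pre \<beta>)"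
      unfolding mult_right[OF that B] by (rule diagram_prod_assoc[OF \<sigma>_partition that prod_in_cat, symmetric])
    then show ?thesis using rank_prod_right[OF prod_in_cat prod_in_cat] by simp
  qed
  have right: "rank (pre (\<xi> \<otimes>\<^bsub>S\<^esub> \<eta>)) \<le> rank (pre \<xi>)"
    if "\<xi> \<in> partition_cat m n" "\<eta> \<in> partition_cat m n" for \<xi> \<eta>
  proof -
    have "pre (\<xi> \<otimes>\<^bsub>S\<^esub> \<eta>) = diagram_prod n n (pre \<xi>) (pre \<eta>)"
      unfolding mult_right[OF that] by (rule diagram_prod_assoc[OF \<sigma>_partition that(1) prod_in_cat, symmetric])
    then show ?thesis using rank_prod_left[OF prod_in_cat prod_in_cat] by simp
  qed
  have "rank (pre \<rho>) \<le> rank (pre \<beta>)"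
    using mem unfolding two_sided_ideal_def carrier_S
    by (auto intro: left right sized_cat_partition B order_trans[OF right left] mult_partition)
  then have "n \<le> rank (pre \<beta>)" using \<rho>(2) rank_perm_diagram[OF permutes_id] by simp
  with \<beta> show ?thesis by (rule D_I)
qed

lemma right_identity_D: "\<rho> \<in> K \<Longrightarrow> pre \<rho> = perm id \<Longrightarrow> \<rho> \<in> D"
  using permutes_id unfolding D_def by blast

lemma maximum_D: "maximum_J_class S D"
proof -
  obtain \<rho> where \<rho>: "\<rho> \<in> K" "pre \<rho> = perm id" using right_identity by blast
  note \<rho>D = right_identity_D[OF \<rho>]
  have "J_rel S `` {\<rho>} = D"
  proof (intro equalityI subsetI)
    fix \<beta> assume "\<beta> \<in> J_rel S `` {\<rho>}"
    then have "\<beta> \<in> K" "\<rho> \<in> two_sided_ideal S \<beta>" using self_in_ideal[of \<rho>] by (auto simp: J_class[OF \<rho>(1)])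
    then show "\<beta> \<in> D" using D_if_right_identity_in_ideal \<rho> by blast
  next
    fix \<beta> assume \<beta>: "\<beta> \<in> D"
    then have "\<beta> \<in> K" by (simp add: D_def)
    then show "\<beta> \<in> J_rel S `` {\<rho>}" by (simp add: J_class[OF \<rho>(1)] ideal_D[OF \<beta>] ideal_D[OF \<rho>D])
  qed
  then have "D \<in> J_classes S" unfolding J_classes_iff using \<rho>(1) by blast
  moreover have "J_le S C D" if C: "C \<in> J_classes S" for C
  proof -
    obtain \<alpha> where "\<alpha> \<in> K" "C = J_rel S `` {\<alpha>}" using C unfolding J_classes_iff by blast
    then have "\<alpha> \<in> C" "\<alpha> \<in> two_sided_ideal S \<rho>" by (simp_all add: J_class ideal_D[OF \<rho>D])
    then show ?thesis using \<rho>D by (auto simp: J_le_def)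
  qed
  ultimately show ?thesis by (simp add: maximum_J_class_def)
qed

text \<open>
  The permutation \<open>\<sigma>\<alpha>\<close>, for \<open>\<alpha> \<in> D\<close>.
\<close>

definition perm_of :: "diagram \<Rightarrow> nat \<Rightarrow> nat" where
  "perm_of \<alpha> = (THE p. p permutes {1..n} \<and> pre \<alpha> = perm p)"

lemma perm_of_eq:
  assumes "p permutes {1..n}" "pre \<alpha> = perm p" shows "perm_of \<alpha> = p"
  unfolding perm_of_def using assms perm_diagram_inj by (intro the_equality) auto

lemma perm_of:
  assumes "\<alpha> \<in> D" shows "perm_of \<alpha> permutes {1..n}" "pre \<alpha> = perm (perm_of \<alpha>)"
  using assms perm_of_eq by (auto simp: D_def)

lemma D_K: "\<alpha> \<in> D \<Longrightarrow> \<alpha> \<in> K"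
  by (simp add: D_def)

lemma D_partition: "\<alpha> \<in> D \<Longrightarrow> \<alpha> \<in> partition_cat m n"
  by (rule sized_cat_partition[OF D_K])

lemma act_D:
  assumes "\<alpha> \<in> D" "q permutes {1..n}"
  shows "act \<alpha> q \<in> D" "perm_of (act \<alpha> q) = perm_of \<alpha> \<circ> q"
proof -
  note pq = permutes_compose[OF assms(2) perm_of(1)[OF assms(1)]]
  note eq = pre_act[OF D_partition[OF assms(1)] perm_of(1)[OF assms(1)] assms(2) perm_of(2)[OF assms(1)]]
  show "act \<alpha> q \<in> D" using act_K[OF D_K[OF assms(1)] assms(2)] eq pq unfolding D_def by blast
  show "perm_of (act \<alpha> q) = perm_of \<alpha> \<circ> q" by (rule perm_of_eq[OF pq eq])
qed

lemma mult_D: "\<alpha> \<in> D \<Longrightarrow> \<beta> \<in> D \<Longrightarrow> \<alpha> \<otimes>\<^bsub>S\<^esub> \<beta> = act \<alpha> (perm_of \<beta>)"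
  by (intro mult_act D_partition perm_of)

text \<open>
  The left-zero factor consists of the right identities in \<open>K\<close>.
\<close>

lemma left_group_D: "left_group_over (S\<lparr>carrier := D\<rparr>) (sym_group n)"
proof -
  let ?D = "S\<lparr>carrier := D\<rparr>"
  define U where "U = {\<epsilon> \<in> K. pre \<epsilon> = perm id}"
  define h where "h \<alpha> = (act \<alpha> (inv_into UNIV (perm_of \<alpha>)), perm_of \<alpha>)" for \<alpha>
  have closed: "\<alpha> \<otimes>\<^bsub>S\<^esub> \<beta> \<in> D" if "\<alpha> \<in> D" "\<beta> \<in> D" for \<alpha> \<beta>
    using mult_D[OF that] act_D(1)[OF that(1) perm_of(1)[OF that(2)]] by simp
  have "is_semigroup ?D"
    by (simp add: is_semigroup_def closed mult_assoc D_partition)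
  moreover have "U \<noteq> {}" using right_identity by (auto simp: U_def)
  moreover have U_D: "U \<subseteq> D" using right_identity_D by (auto simp: U_def)
  have "h \<in> iso ?D (left_zero U \<times>\<times> sym_group n)"
  proof (rule isoI)
    have hU: "act \<alpha> (inv_into UNIV (perm_of \<alpha>)) \<in> U" if \<alpha>: "\<alpha> \<in> D" for \<alpha>
    proof -
      note p = perm_of[OF \<alpha>]
      have "act \<alpha> (inv_into UNIV (perm_of \<alpha>)) \<in> K" by (rule act_K[OF D_K[OF \<alpha>] permutes_inv[OF p(1)]])
      moreover have "pre (act \<alpha> (inv_into UNIV (perm_of \<alpha>))) = perm id"
        using pre_act[OF D_partition[OF \<alpha>] p(1) permutes_inv[OF p(1)] p(2)] permutes_inv_o(1)[OF p(1)] by simp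
      ultimately show ?thesis by (simp add: U_def)
    qed
    have restore: "act (act \<alpha> (inv_into UNIV (perm_of \<alpha>))) (perm_of \<alpha>) = \<alpha>" if \<alpha>: "\<alpha> \<in> D" for \<alpha>
      using act_act[OF D_partition[OF \<alpha>] permutes_inv[OF perm_of(1)[OF \<alpha>]] perm_of(1)[OF \<alpha>]]
        permutes_inv_o(2)[OF perm_of(1)[OF \<alpha>]] act_id[OF D_partition[OF \<alpha>]] by simp
    show "h \<in> hom ?D (left_zero U \<times>\<times> sym_group n)"
    proof (rule homI)
      show "h \<alpha> \<in> carrier (left_zero U \<times>\<times> sym_group n)" if "\<alpha> \<in> carrier ?D" for \<alpha>
        using that hU perm_of(1) by (simp add: h_def left_zero_def sym_group_def)
      fix \<alpha> \<beta> assume "\<alpha> \<in> carrier ?D" "\<beta> \<in> carrier ?D"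
      then have \<alpha>: "\<alpha> \<in> D" and \<beta>: "\<beta> \<in> D" by simp_all
      let ?p = "perm_of \<alpha>" and ?q = "perm_of \<beta>"
      note p = perm_of(1)[OF \<alpha>] and q = perm_of(1)[OF \<beta>]
      have pq: "perm_of (\<alpha> \<otimes>\<^bsub>S\<^esub> \<beta>) = ?p \<circ> ?q"
        using act_D(2)[OF \<alpha> q] mult_D[OF \<alpha> \<beta>] by simp
      have "?q \<circ> inv_into UNIV (?p \<circ> ?q) = inv_into UNIV ?p"
        using o_inv_distrib[OF permutes_bij[OF p] permutes_bij[OF q]] permutes_inv_o(1)[OF q]
        by (metis comp_assoc id_comp)
      then have "act (\<alpha> \<otimes>\<^bsub>S\<^esub> \<beta>) (inv_into UNIV (?p \<circ> ?q)) = act \<alpha> (inv_into UNIV ?p)"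
        using act_act[OF D_partition[OF \<alpha>] q permutes_inv[OF permutes_compose[OF q p]]] mult_D[OF \<alpha> \<beta>] by simp
      then show "h (\<alpha> \<otimes>\<^bsub>?D\<^esub> \<beta>) = h \<alpha> \<otimes>\<^bsub>left_zero U \<times>\<times> sym_group n\<^esub> h \<beta>"
        by (simp add: h_def pq left_zero_def sym_group_def DirProd_def)
    qed
    have "inj_on h D"
      using restore by (intro inj_onI) (metis h_def prod.inject)
    moreover have "h ` D = U \<times> {p. p permutes {1..n}}"
    proof (intro equalityI subsetI)
      show "x \<in> U \<times> {p. p permutes {1..n}}" if "x \<in> h ` D" for x
        using that hU perm_of(1) by (auto simp: h_def)
      fix x assume "x \<in> U \<times> {p. p permutes {1..n}}"
      then obtain \<epsilon> p where x: "x = (\<epsilon>, p)" "\<epsilon> \<in> U" and p: "p permutes {1..n}" by auto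
      then have \<epsilon>D: "\<epsilon> \<in> D" and "perm_of \<epsilon> = id" using U_D perm_of_eq[OF permutes_id] by (auto simp: U_def)
      then have "perm_of (act \<epsilon> p) = p" using act_D(2)[OF _ p] by simp
      moreover have "act (act \<epsilon> p) (inv_into UNIV p) = \<epsilon>"
        using act_act[OF D_partition[OF \<epsilon>D] p permutes_inv[OF p]] permutes_inv_o(1)[OF p]
          act_id[OF D_partition[OF \<epsilon>D]] by simp
      ultimately have "h (act \<epsilon> p) = x" by (simp add: h_def x(1))
      then show "x \<in> h ` D" using act_D(1)[OF \<epsilon>D p] by blast
    qed
    ultimately show "bij_betw h (carrier ?D) (carrier (left_zero U \<times>\<times> sym_group n))"
      by (simp add: bij_betw_def left_zero_def sym_group_def)
  qed
  ultimately show ?thesis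
    unfolding left_group_over_def is_iso_def using sym_group_is_group by blast
qed

end

theorem proposition5p9:
  fixes K :: "nat \<Rightarrow> nat \<Rightarrow> diagram set" and m n r :: nat and \<sigma> :: diagram
  assumes "K \<in> {partition_cat, partial_brauer_cat, brauer_cat}"
    and "m \<ge> n"
    and "\<sigma> \<in> K n m"
    and "r = rank \<sigma>"
  shows "(r < n \<longrightarrow>
            {C. maximal_J_class (sandwich K m n \<sigma>) C} = {{\<alpha>} | \<alpha>. \<alpha> \<in> K m n \<and> rank \<alpha> > r}) \<and>
         (r = n \<longrightarrow>
            maximum_J_class (sandwich K m n \<sigma>) (D_class K m n \<sigma> r) \<and>
            left_group_over ((sandwich K m n \<sigma>)\<lparr>carrier := D_class K m n \<sigma> r\<rparr>) (sym_group r))"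
proof -
  have cats: "partition_cat = sized_cat UNIV" "partial_brauer_cat = sized_cat {1, 2}" "brauer_cat = sized_cat {2}"
    by (auto simp: fun_eq_iff sized_cat_def partial_brauer_cat_def brauer_cat_def)
  obtain s where s: "s \<in> {UNIV, {1, 2}, {2}}" "K = sized_cat s"
    using assms(1) unfolding cats by blast
  interpret sandwich_category s m n \<sigma>
    by unfold_locales (use s assms(3) in simp_all)
  show ?thesis
  proof (intro conjI impI)
    assume "r < n"
    then show "{C. maximal_J_class (sandwich K m n \<sigma>) C} = {{\<alpha>} | \<alpha>. \<alpha> \<in> K m n \<and> rank \<alpha> > r}"
      using maximal_J_classes assms(2,4) s(2) by simp
  next
    assume r: "r = n"
    interpret full_rank_sandwich s m n \<sigma>
      by unfold_locales (use r assms(4) in simp)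
    show "maximum_J_class (sandwich K m n \<sigma>) (D_class K m n \<sigma> r)"
      using maximum_D by (simp add: s(2) r D_class_eq)
    show "left_group_over ((sandwich K m n \<sigma>)\<lparr>carrier := D_class K m n \<sigma> r\<rparr>) (sym_group r)"
      using left_group_D by (simp add: s(2) r D_class_eq)
  qed
qed

end
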